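(* Let $m\geq 3$. There does not exist any recurrent real hypersurface $M$ in the complex two-plane Grassmannian $G_2(\mathbb C_{m+2})$.
   Context: $G_2(\mathbb C_{m+2})$ is the set of complex two-dimensional linear subspaces of $\mathbb C^{m+2}$ (real dimension $4m$), a compact irreducible Riemannian symmetric space with metric $\langle\cdot,\cdot\rangle$, Kaehler structure $J$ and quaternionic Kaehler structure $\mathfrak J$ (a parallel rank-3 subbundle of the endomorphism bundle, not containing $J$). Under the identification $T_WG_2(\mathbb C_{m+2})=\mathrm{Hom}_{\mathbb C}(W,W^\perp)$, $J$ is multiplication by $i$ and $\mathfrak J_W=\{X\mapsto X\circ B: B\in\mathfrak{su}(W)\}$. A canonical local basis $\{J_1,J_2,J_3\}$ of $\mathfrak J$ consists of local almost Hermitian structures with $J_aJ_{a+1}=J_{a+2}=-J_{a+1}J_a$ (indices mod 3); one has $JJ_a=J_aJ$ and $\mathrm{Trace}(JJ_a)=0$. The metric is normalized so that the curvature tensor is $$\hat R(X,Y)Z=\langle Y,Z\rangle X-\langle X,Z\rangle Y+\langle JY,Z\rangle JX-\langle JX,Z\rangle JY-2\langle JX,Y\rangle JZ+\sum_{a=1}^3\{\langle J_aY,Z\rangle J_aX-\langle J_aX,Z\rangle J_aY-2\langle J_aX,Y\rangle J_aZ+\langle JJ_aY,Z\rangle JJ_aX-\langle JJ_aX,Z\rangle JJ_aY\}.$$ A real hypersurface $M$ is a connected oriented manifold of real dimension $4m-1$ isometrically immersed in $G_2(\mathbb C_{m+2})$; $N$ is a unit normal vector field, $A$ the shape operator ($AX=-\hat\nabla_XN$,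 $\hat\nabla$ the Levi-Civita connection of the ambient space) and $\nabla$ the Levi-Civita connection of $M$. $M$ is recurrent if its second fundamental form is recurrent; for a hypersurface this means that $A$ is not identically zero and there is a $1$-form $\omega$ on $M$ with $(\nabla_XA)Y=\omega(X)AY$ for all $X,Y\in TM$. *)

theory Defs
  imports "HOL-Analysis.Analysis"
begin

abbreviation D :: "('a::real_normed_vector \<Rightarrow> 'b::real_normed_vector) \<Rightarrow> 'a \<Rightarrow> 'a \<Rightarrow> 'b" where
  "D h x \<equiv> frechet_derivative h (at x)"

primrec Ck_on :: "nat \<Rightarrow> 'a::real_normed_vector set \<Rightarrow> ('a \<Rightarrow> 'b::real_normed_vector) \<Rightarrow> bool" where
  "Ck_on 0 S h \<longleftrightarrow> continuous_on S h"
| "Ck_on (Suc k) S h \<longleftrightarrow> (\<forall>x\<in>S. h differentiable (at x)) \<and> (\<forall>v. Ck_on k S (\<lambda>x. D h x v))"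

definition smooth_on :: "'a::real_normed_vector set \<Rightarrow> ('a \<Rightarrow> 'b::real_normed_vector) \<Rightarrow> bool" where
  "smooth_on S h \<longleftrightarrow> (\<forall>k. Ck_on k S h)"


section \<open>Manifolds given by an atlas\<close>

text \<open>A chart is a pair of its domain and its coordinate map; the coordinate map is only relevant
  on the domain.\<close>

type_synonym ('a, 'e) chart = "'a set \<times> ('a \<Rightarrow> 'e)"

definition chart_inv :: "('a, 'e) chart \<Rightarrow> 'e \<Rightarrow> 'a" where
  "chart_inv c = inv_into (fst c) (snd c)"

definition coord_map :: "('a, 'e) chart \<Rightarrow> ('b, 'd) chart \<Rightarrow> ('a \<Rightarrow> 'b) \<Rightarrow> 'e \<Rightarrow> 'd" where
  "coord_map c d f = snd d \<circ> f \<circ> chart_inv c"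

definition overlap :: "('a, 'e) chart \<Rightarrow> ('b, 'd) chart \<Rightarrow> ('a \<Rightarrow> 'b) \<Rightarrow> 'a set" where
  "overlap c d f = {p \<in> fst c. f p \<in> fst d}"

abbreviation transition :: "('a, 'e) chart \<Rightarrow> ('a, 'e) chart \<Rightarrow> 'e \<Rightarrow> 'e" where
  "transition c c' \<equiv> coord_map c c' id"

definition smooth_manifold :: "'a topology \<Rightarrow> ('a, 'e::euclidean_space) chart set \<Rightarrow> bool" where
  "smooth_manifold T \<A> \<longleftrightarrow>
     Hausdorff_space T \<and> second_countable T \<and> (\<Union>c\<in>\<A>. fst c) = topspace T \<and>
     (\<forall>c\<in>\<A>. openin T (fst c) \<and> open (snd c ` fst c) \<and>
        homeomorphic_map (subtopology T (fst c)) (top_of_set (snd c ` fst c)) (snd c)) \<and>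
     (\<forall>c\<in>\<A>. \<forall>c'\<in>\<A>. smooth_on (snd c ` (fst c \<inter> fst c')) (transition c c'))"

definition oriented_atlas :: "('a, real^'k) chart set \<Rightarrow> bool" where
  "oriented_atlas \<A> \<longleftrightarrow>
     (\<forall>c\<in>\<A>. \<forall>c'\<in>\<A>. \<forall>p \<in> fst c \<inter> fst c'. det (matrix (D (transition c c') (snd c p))) > 0)"

text \<open>Tangent vectors and covectors are families of components, one for each chart around the
  base point, that obey the respective transformation law.\<close>

definition tangent_vector ::
    "('b, 'd::euclidean_space) chart set \<Rightarrow> 'b \<Rightarrow> (('b, 'd) chart \<Rightarrow> 'd) \<Rightarrow> bool" where
  "tangent_vector \<B> q t \<longleftrightarrow>
     (\<forall>d\<in>\<B>. \<forall>d'\<in>\<B>. q \<in> fst d \<inter> fst d' \<longrightarrow> t d' = D (transition d d') (snd d q) (t d))"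

definition one_form ::
    "('a, 'e::euclidean_space) chart set \<Rightarrow> ('a \<Rightarrow> ('a, 'e) chart \<Rightarrow> 'e \<Rightarrow> real) \<Rightarrow> bool" where
  "one_form \<A> \<omega> \<longleftrightarrow>
     (\<forall>c\<in>\<A>. (\<forall>p\<in>fst c. linear (\<omega> p c)) \<and>
        (\<forall>u. smooth_on (snd c ` fst c) (\<lambda>x. \<omega> (chart_inv c x) c u))) \<and>
     (\<forall>c\<in>\<A>. \<forall>c'\<in>\<A>. \<forall>p \<in> fst c \<inter> fst c'. \<forall>u.
        \<omega> p c u = \<omega> p c' (D (transition c c') (snd c p) u))"

text \<open>The target of an immersion is described by an atlas \<open>\<B>\<close>. Continuity is expressed by the
  openness of the preimages of the chart domains, together with the continuity of the coordinate
  expressions.\<close>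

definition immersion ::
    "'a topology \<Rightarrow> ('a, 'e::euclidean_space) chart set \<Rightarrow> ('b, 'd::euclidean_space) chart set \<Rightarrow>
     ('a \<Rightarrow> 'b) \<Rightarrow> bool" where
  "immersion T \<A> \<B> f \<longleftrightarrow>
     (\<forall>c\<in>\<A>. \<forall>d\<in>\<B>. openin T (overlap c d f) \<and>
        smooth_on (snd c ` overlap c d f) (coord_map c d f) \<and>
        (\<forall>p\<in>overlap c d f. inj (D (coord_map c d f) (snd c p))))"


section \<open>Riemannian metrics and Levi-Civita connections in coordinates\<close>

text \<open>\<open>g y u v\<close> is the inner product of the tangent vectors with components \<open>u\<close>, \<open>v\<close> at the point
  with coordinates \<open>y\<close>.\<close>

type_synonym 'e local_metric = "'e \<Rightarrow> 'e \<Rightarrow> 'e \<Rightarrow> real"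

text \<open>The components of the Levi-Civita covariant derivative of the coordinate field \<open>v\<close> in the
  direction \<open>u\<close>, given by the Koszul formula for coordinate (hence commuting) vector fields.\<close>

definition christoffel :: "'e::euclidean_space local_metric \<Rightarrow> 'e \<Rightarrow> 'e \<Rightarrow> 'e \<Rightarrow> 'e" where
  "christoffel g y u v = (THE w. \<forall>z.
     2 * g y w z = D (\<lambda>y. g y v z) y u + D (\<lambda>y. g y u z) y v - D (\<lambda>y. g y u v) y z)"

definition pullback_metric ::
    "'d::euclidean_space local_metric \<Rightarrow> ('e::euclidean_space \<Rightarrow> 'd) \<Rightarrow> 'e local_metric" where
  "pullback_metric g F x u v = g (F x) (D F x u) (D F x v)"

text \<open>Covariant derivative, in direction \<open>u\<close> at \<open>x\<close>, of the vector field with components \<open>n\<close>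
  along the map \<open>F\<close>.\<close>

definition cov_deriv_along ::
    "'d::euclidean_space local_metric \<Rightarrow> ('e::euclidean_space \<Rightarrow> 'd) \<Rightarrow> ('e \<Rightarrow> 'd) \<Rightarrow> 'e \<Rightarrow> 'e \<Rightarrow> 'd" where
  "cov_deriv_along g F n x u = D n x u + christoffel g (F x) (D F x u) (n x)"

definition cov_deriv_endo ::
    "'e::euclidean_space local_metric \<Rightarrow> ('e \<Rightarrow> 'e \<Rightarrow> 'e) \<Rightarrow> 'e \<Rightarrow> 'e \<Rightarrow> 'e \<Rightarrow> 'e" where
  "cov_deriv_endo g A x u w =
     D (\<lambda>x. A x w) x u + christoffel g x u (A x w) - A x (christoffel g x u w)"


section \<open>Oriented hypersurfaces\<close>

text \<open>\<open>G d\<close> is the local expression of the ambient metric in the chart \<open>d\<close>. The vector field \<open>N\<close>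
  along the immersion assigns to a point the family of components of a tangent vector.\<close>

definition unit_normal_field ::
    "('a, 'e::euclidean_space) chart set \<Rightarrow> ('b, 'd::euclidean_space) chart set \<Rightarrow>
     (('b, 'd) chart \<Rightarrow> 'd local_metric) \<Rightarrow> ('a \<Rightarrow> 'b) \<Rightarrow> ('a \<Rightarrow> ('b, 'd) chart \<Rightarrow> 'd) \<Rightarrow> bool" where
  "unit_normal_field \<A> \<B> G f N \<longleftrightarrow>
     (\<forall>c\<in>\<A>. \<forall>p\<in>fst c. tangent_vector \<B> (f p) (N p)) \<and>
     (\<forall>c\<in>\<A>. \<forall>d\<in>\<B>. smooth_on (snd c ` overlap c d f) (\<lambda>x. N (chart_inv c x) d) \<and>
        (\<forall>p\<in>overlap c d f. G d (snd d (f p)) (N p d) (N p d) = 1 \<and>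
           (\<forall>u. G d (snd d (f p)) (N p d) (D (coord_map c d f) (snd c p) u) = 0)))"

text \<open>The hypersurface carries the metric induced by \<open>f\<close>, which makes \<open>f\<close> isometric. Its metric
  and its shape operator in a chart \<open>c\<close> are computed with the help of a chart \<open>d\<close> of the ambient
  space, on the part of the domain of \<open>c\<close> that \<open>f\<close> maps into the domain of \<open>d\<close>; the result does
  not depend on \<open>d\<close>.\<close>

definition induced_metric ::
    "(('b, 'd::euclidean_space) chart \<Rightarrow> 'd local_metric) \<Rightarrow> ('a \<Rightarrow> 'b) \<Rightarrow>
     ('a, 'e::euclidean_space) chart \<Rightarrow> ('b, 'd) chart \<Rightarrow> 'e local_metric" where
  "induced_metric G f c d = pullback_metric (G d) (coord_map c d f)"

definition shape_operator ::
    "(('b, 'd::euclidean_space) chart \<Rightarrow> 'd local_metric) \<Rightarrow> ('a \<Rightarrow> 'b) \<Rightarrow>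
     ('a \<Rightarrow> ('b, 'd) chart \<Rightarrow> 'd) \<Rightarrow> ('a, 'e::euclidean_space) chart \<Rightarrow> ('b, 'd) chart \<Rightarrow>
     'e \<Rightarrow> 'e \<Rightarrow> 'e" where
  "shape_operator G f N c d x u = (THE v.
     D (coord_map c d f) x v =
       - cov_deriv_along (G d) (coord_map c d f) (\<lambda>x. N (chart_inv c x) d) x u)"

definition recurrent_hypersurface ::
    "('a, 'e::euclidean_space) chart set \<Rightarrow> ('b, 'd::euclidean_space) chart set \<Rightarrow>
     (('b, 'd) chart \<Rightarrow> 'd local_metric) \<Rightarrow> ('a \<Rightarrow> 'b) \<Rightarrow> ('a \<Rightarrow> ('b, 'd) chart \<Rightarrow> 'd) \<Rightarrow> bool" where
  "recurrent_hypersurface \<A> \<B> G f N \<longleftrightarrow>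
     (\<exists>c\<in>\<A>. \<exists>d\<in>\<B>. \<exists>p\<in>overlap c d f. \<exists>u. shape_operator G f N c d (snd c p) u \<noteq> 0) \<and>
     (\<exists>\<omega>. one_form \<A> \<omega> \<and>
        (\<forall>c\<in>\<A>. \<forall>d\<in>\<B>. \<forall>p\<in>overlap c d f. \<forall>u w.
           cov_deriv_endo (induced_metric G f c d) (shape_operator G f N c d) (snd c p) u w =
             \<omega> p c u *\<^sub>R shape_operator G f N c d (snd c p) w))"


section \<open>The Grassmannian of complex two-planes\<close>

text \<open>With \<open>m = CARD('m)\<close>, the space \<open>\<complex>\<^sup>m\<^sup>+\<^sup>2\<close> is \<open>complex^('m + 2)\<close>, where \<open>2\<close> is the
  two-element type, and \<open>complex^2^'m\<close> is the space of complex \<open>m \<times> 2\<close> matrices.\<close>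

definition two_planes :: "(complex^('m::finite + 2)) set set" where
  "two_planes = {W. vec.subspace W \<and> vec.dim W = 2}"

text \<open>Affine charts: for an invertible matrix \<open>A\<close>, the \<open>m \<times> 2\<close> matrix \<open>y\<close> is the coordinate of
  the image under \<open>A\<close> of the graph of \<open>y\<close>.\<close>

definition graph_plane ::
    "complex^('m::finite + 2)^('m + 2) \<Rightarrow> complex^2^'m \<Rightarrow> (complex^('m + 2)) set" where
  "graph_plane A y =
     range (\<lambda>z. A *v (\<chi> i. case i of Inl j \<Rightarrow> (y *v z) $ j | Inr k \<Rightarrow> z $ k))"

definition grass_atlas :: "((complex^('m::finite + 2)) set, complex^2^'m) chart set" where
  "grass_atlas = {(range (graph_plane A), inv (graph_plane A)) | A. invertible A}"

definition adjoint_matrix :: "complex^'n^'l \<Rightarrow> complex^'l^'n" where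
  "adjoint_matrix X = (\<chi> i j. cnj (X $ j $ i))"

definition orth_projector :: "(complex^'n) set \<Rightarrow> complex^'n^'n" where
  "orth_projector W = (THE P. adjoint_matrix P = P \<and> P ** P = P \<and> range ((*v) P) = W)"

text \<open>The identification of the tangent space at \<open>W\<close> with the complex linear maps from \<open>W\<close> to its
  orthogonal complement, the latter being represented by matrices that vanish on the orthogonal
  complement. A curve \<open>W(t)\<close> of planes with orthogonal projectors \<open>P(t)\<close> has as velocity the map
  that sends \<open>w(0)\<close> to the component of \<open>w'(0)\<close> orthogonal to \<open>W(0)\<close>, where \<open>w(t) \<in> W(t)\<close>.
  Differentiating \<open>P(t) w(t) = w(t)\<close> shows that this map is the restriction of \<open>P'(0)\<close> to
  \<open>W(0)\<close>.\<close>

definition hom_vector ::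
    "((complex^('m::finite + 2)) set, complex^2^'m) chart \<Rightarrow> complex^2^'m \<Rightarrow> complex^2^'m \<Rightarrow>
     complex^('m + 2)^('m + 2)" where
  "hom_vector d y u =
     D (\<lambda>y. orth_projector (chart_inv d y)) y u ** orth_projector (chart_inv d y)"

text \<open>The metric is \<open>\<langle>X, Y\<rangle> = Re (Trace (X\<^sup>* Y)) / 2\<close>. The factor \<open>1/2\<close> normalizes the maximal
  sectional curvature to \<open>8\<close>, which is the value for the plane spanned by \<open>X\<close> and \<open>J X\<close> with \<open>X\<close>
  of rank one, and amounts to
  \<open>R(X,Y)Z = \<langle>Y,Z\<rangle>X - \<langle>X,Z\<rangle>Y + \<langle>JY,Z\<rangle>JX - \<langle>JX,Z\<rangle>JY - 2\<langle>JX,Y\<rangle>JZ + \<dots>\<close>.\<close>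

definition grass_metric ::
    "((complex^('m::finite + 2)) set, complex^2^'m) chart \<Rightarrow> (complex^2^'m) local_metric" where
  "grass_metric d y u v =
     Re (trace (adjoint_matrix (hom_vector d y u) ** hom_vector d y v)) / 2"

definition real_hypersurface ::
    "'a topology \<Rightarrow> ('a, real^'k) chart set \<Rightarrow> ('a \<Rightarrow> (complex^('m::finite + 2)) set) \<Rightarrow>
     ('a \<Rightarrow> ((complex^('m + 2)) set, complex^2^'m) chart \<Rightarrow> complex^2^'m) \<Rightarrow> bool" where
  "real_hypersurface T \<A> f N \<longleftrightarrow>
     CARD('k) = 4 * CARD('m) - 1 \<and>
     smooth_manifold T \<A> \<and> connected_space T \<and> oriented_atlas \<A> \<and>
     f ` topspace T \<subseteq> two_planes \<and> immersion T \<A> grass_atlas f \<and>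
     unit_normal_field \<A> grass_atlas grass_metric f N"

end

theory Submission
  imports Defs
begin

text \<open>By the Codazzi equation, recurrence forces \<open>\<omega>(X) A Y - \<omega>(Y) A X\<close> to be the curvature term
  \<open>R(X,Y) N\<close>, up to sign and modulo \<open>N\<close>. This already fails at every single point: in
  \<open>Hom(W, W\<^sup>\<bottom>)\<close>, with \<open>m \<ge> 3\<close>, there is a nonzero vector \<open>e\<close> orthogonal to both columns of
  \<open>N\<close>, and the matrices with columns in \<open>\<complex> e\<close> are tangent. Those with only the first and those with
  only the second column nonzero form real planes, hence contain nonzero \<open>X\<close> and \<open>Y\<close> in the kernel
  of \<open>\<omega>\<close>. For them \<open>R(X,Y) N = N (X\<^sup>* Y - Y\<^sup>* X)\<close>, again up to sign, which is not a real multiple of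
  \<open>N\<close>. The curvature is computed in an affine chart given by a unitary frame at the point, where the
  Christoffel symbols vanish at the origin.\<close>

section \<open>Calculus on open sets\<close>

text \<open>The objects in the definitions (\<open>christoffel\<close>,
  \<open>shape_operator\<close>, \<open>orth_projector\<close>) are definite descriptions, so none
  can be differentiated before a formula or a defining equation replaces it. The ambient Christoffel
  symbols and the projectors get closed forms. The shape operator gets none: its differentiability
  needs its own proof, because the Codazzi equation arises by differentiating the equation that
  defines it. Unitarity of the frame matters because the metric in an affine chart depends on the
  frame matrix \<open>A\<close> only through \<open>adj A ** A\<close>. Hence every plane can be
  made the origin of one and the same explicit metric, and there the curvature is the
  antisymmetrized derivative of the Christoffel symbols, without quadratic terms. Normal components
  are never computed: the final algebra excludes every real multiple of the normal vector, so an
  unknown real \<mu> suffices throughout.\<close>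

lemma smooth_on_differentiable: "smooth_on S h \<Longrightarrow> x \<in> S \<Longrightarrow> h differentiable (at x)"
  unfolding smooth_on_def by (drule spec[of _ "Suc 0"]) simp

lemma smooth_on_D: "smooth_on S h \<Longrightarrow> smooth_on S (\<lambda>x. D h x v)"
  unfolding smooth_on_def by (metis Ck_on.simps(2))

lemma smooth_on_continuous: "smooth_on S h \<Longrightarrow> continuous_on S h"
  unfolding smooth_on_def by (drule spec[of _ 0]) simp

lemma smooth_on_has_derivative:
  "smooth_on S h \<Longrightarrow> x \<in> S \<Longrightarrow> (h has_derivative D h x) (at x)"
  by (simp add: smooth_on_differentiable flip: frechet_derivative_works)

lemma frechet_derivativeI: "(f has_derivative f') (at x) \<Longrightarrow> D f x = f'"
  by (metis frechet_derivative_at)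

text \<open>The mean value theorem is used once in direction \<open>u\<close> and once in direction
  \<open>v\<close>. The left-hand side is symmetric in \<open>u\<close> and \<open>v\<close>, while
  the right-hand side fixes an order of differentiation; this contrast is what the symmetry of
  second derivatives rests on.\<close>

lemma second_difference_mean_value:
  fixes \<phi> :: "'a::real_normed_vector \<Rightarrow> real"
  assumes h: "0 < h"
    and S: "\<And>s t. 0 \<le> s \<Longrightarrow> s \<le> h \<Longrightarrow> 0 \<le> t \<Longrightarrow> t \<le> h \<Longrightarrow> x + s *\<^sub>R u + t *\<^sub>R v \<in> S"
    and \<phi>: "\<And>y. y \<in> S \<Longrightarrow> \<phi> differentiable (at y)"
    and \<phi>u: "\<And>y. y \<in> S \<Longrightarrow> (\<lambda>y. D \<phi> y u) differentiable (at y)"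
  obtains s t where "0 < s" "s < h" "0 < t" "t < h"
    "\<phi> (x + h *\<^sub>R u + h *\<^sub>R v) - \<phi> (x + h *\<^sub>R u) - \<phi> (x + h *\<^sub>R v) + \<phi> x =
      h * h * D (\<lambda>y. D \<phi> y u) (x + s *\<^sub>R u + t *\<^sub>R v) v"
proof -
  have line: "((\<lambda>s. k (a + s *\<^sub>R w)) has_real_derivative D k (a + s *\<^sub>R w) w) (at s)"
    if "k differentiable (at (a + s *\<^sub>R w))" for k :: "'a \<Rightarrow> real" and a w s
  proof -
    have 1: "(k has_derivative D k (a + s *\<^sub>R w)) (at (a + s *\<^sub>R w))"
      using that by (simp flip: frechet_derivative_works)
    have 2: "((\<lambda>s. a + s *\<^sub>R w) has_derivative (\<lambda>h. h *\<^sub>R w)) (at s)"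
      by (auto intro!: derivative_eq_intros)
    have "((\<lambda>s. k (a + s *\<^sub>R w)) has_derivative (\<lambda>h. D k (a + s *\<^sub>R w) (h *\<^sub>R w))) (at s)"
      using has_derivative_compose[OF 2 1] .
    moreover have "D k (a + s *\<^sub>R w) (h *\<^sub>R w) = h * D k (a + s *\<^sub>R w) w" for h
      using linear_scale[OF has_derivative_linear[OF 1]] by simp
    ultimately show ?thesis
      by (simp add: has_field_derivative_def mult.commute[of _ "D k _ _"])
  qed
  define \<psi> where "\<psi> s = \<phi> ((x + h *\<^sub>R v) + s *\<^sub>R u) - \<phi> (x + s *\<^sub>R u)" for s
  have "\<exists>s. 0 < s \<and> s < h \<and> \<psi> h - \<psi> 0 =
      (h - 0) * (D \<phi> ((x + h *\<^sub>R v) + s *\<^sub>R u) u - D \<phi> (x + s *\<^sub>R u) u)"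
  proof (rule MVT2[OF h])
    fix s assume s: "0 \<le> s" "s \<le> h"
    have "x + s *\<^sub>R u \<in> S" "x + h *\<^sub>R v + s *\<^sub>R u \<in> S"
      using S[OF s, of 0] S[OF s, of h] h by (simp_all add: algebra_simps)
    then show "(\<psi> has_real_derivative (D \<phi> ((x + h *\<^sub>R v) + s *\<^sub>R u) u - D \<phi> (x + s *\<^sub>R u) u)) (at s)"
      unfolding \<psi>_def by (intro DERIV_diff line \<phi>)
  qed
  then obtain s where s: "0 < s" "s < h" "\<psi> h - \<psi> 0 =
      h * (D \<phi> ((x + h *\<^sub>R v) + s *\<^sub>R u) u - D \<phi> (x + s *\<^sub>R u) u)" by auto
  have "\<exists>t. 0 < t \<and> t < h \<and> D \<phi> ((x + s *\<^sub>R u) + h *\<^sub>R v) u - D \<phi> ((x + s *\<^sub>R u) + 0 *\<^sub>R v) u =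
      (h - 0) * D (\<lambda>y. D \<phi> y u) ((x + s *\<^sub>R u) + t *\<^sub>R v) v"
    by (rule MVT2[OF h]) (use S s in \<open>auto intro!: line \<phi>u\<close>)
  then obtain t where t: "0 < t" "t < h" "D \<phi> ((x + s *\<^sub>R u) + h *\<^sub>R v) u - D \<phi> (x + s *\<^sub>R u) u =
      h * D (\<lambda>y. D \<phi> y u) (x + s *\<^sub>R u + t *\<^sub>R v) v" by auto
  have "D \<phi> ((x + h *\<^sub>R v) + s *\<^sub>R u) u - D \<phi> (x + s *\<^sub>R u) u =
      h * D (\<lambda>y. D \<phi> y u) (x + s *\<^sub>R u + t *\<^sub>R v) v"
    using t(3) by (simp add: algebra_simps)
  then have "\<psi> h - \<psi> 0 = h * h * D (\<lambda>y. D \<phi> y u) (x + s *\<^sub>R u + t *\<^sub>R v) v"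
    using s(3) by simp
  then show ?thesis
    using that[OF s(1,2) t(1,2)] by (simp add: \<psi>_def algebra_simps)
qed

text \<open>Both orders share the same second difference, so the two iterated derivatives take a
  common value at points arbitrarily close to \<open>x\<close>; continuity carries the equality to
  \<open>x\<close> itself.\<close>

lemma second_derivative_symmetric_real:
  fixes \<phi> :: "'a::real_normed_vector \<Rightarrow> real"
  assumes S: "open S" "x \<in> S" and \<phi>: "smooth_on S \<phi>"
  shows "D (\<lambda>y. D \<phi> y u) x v = D (\<lambda>y. D \<phi> y v) x u"
proof (rule ccontr)
  define a where "a w z = (\<lambda>y. D (\<lambda>y. D \<phi> y w) y z)" for w z
  assume "\<not> ?thesis"
  then have pos: "\<bar>a u v x - a v u x\<bar> / 2 > 0" by (simp add: a_def)
  have cont: "isCont (a w z) x" for w z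
    using smooth_on_continuous[OF smooth_on_D[OF smooth_on_D[OF \<phi>, of w], of z]] S
    by (simp add: continuous_on_eq_continuous_at a_def)
  obtain d1 where d1: "d1 > 0" "\<And>y. dist y x < d1 \<Longrightarrow> dist (a u v y) (a u v x) < \<bar>a u v x - a v u x\<bar> / 2"
    using cont[of u v] pos unfolding continuous_at_eps_delta by blast
  obtain d2 where d2: "d2 > 0" "\<And>y. dist y x < d2 \<Longrightarrow> dist (a v u y) (a v u x) < \<bar>a u v x - a v u x\<bar> / 2"
    using cont[of v u] pos unfolding continuous_at_eps_delta by blast
  obtain d3 where d3: "d3 > 0" "\<And>y. dist y x < d3 \<Longrightarrow> y \<in> S"
    using S by (meson open_dist)
  define d where "d = min d1 (min d2 d3)"
  have d: "d > 0" using d1 d2 d3 by (simp add: d_def)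
  \<comment> \<open>The \<open>+ 1\<close> keeps the denominator positive when
    \<open>u = v = 0\<close>; the factor 2 leaves the parallelogram strictly inside the ball of
    radius \<open>d\<close>.\<close>
  define h where "h = d / (2 * (norm u + norm v + 1))"
  have h: "h > 0" using d by (simp add: h_def add_nonneg_pos)
  have near: "dist (x + s *\<^sub>R u + t *\<^sub>R v) x < d" if "0 \<le> s" "s \<le> h" "0 \<le> t" "t \<le> h" for s t
  proof -
    have "dist (x + s *\<^sub>R u + t *\<^sub>R v) x \<le> s * norm u + t * norm v"
      using norm_triangle_ineq[of "s *\<^sub>R u" "t *\<^sub>R v"] that by (simp add: dist_norm add.assoc)
    also have "\<dots> \<le> h * norm u + h * norm v"
      using that by (intro add_mono mult_right_mono) auto
    also have "\<dots> \<le> h * (norm u + norm v + 1)" using h by (simp add: algebra_simps)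
    also have "\<dots> = d / 2"
      using add_nonneg_pos[of "norm u + norm v" 1] by (simp add: h_def field_simps)
    finally show ?thesis using d by simp
  qed
  have inS: "x + s *\<^sub>R u + t *\<^sub>R v \<in> S" if "0 \<le> s" "s \<le> h" "0 \<le> t" "t \<le> h" for s t
    using near[OF that] d3 by (simp add: d_def)
  obtain s t where st: "0 < s" "s < h" "0 < t" "t < h"
    "\<phi> (x + h *\<^sub>R u + h *\<^sub>R v) - \<phi> (x + h *\<^sub>R u) - \<phi> (x + h *\<^sub>R v) + \<phi> x =
      h * h * a u v (x + s *\<^sub>R u + t *\<^sub>R v)"
    unfolding a_def
    by (rule second_difference_mean_value[OF h, of x u v S \<phi>])
      (auto intro: inS smooth_on_differentiable[OF \<phi>] smooth_on_differentiable[OF smooth_on_D[OF \<phi>]])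
  obtain t' s' where st': "0 < t'" "t' < h" "0 < s'" "s' < h"
    "\<phi> (x + h *\<^sub>R v + h *\<^sub>R u) - \<phi> (x + h *\<^sub>R v) - \<phi> (x + h *\<^sub>R u) + \<phi> x =
      h * h * a v u (x + t' *\<^sub>R v + s' *\<^sub>R u)"
    unfolding a_def
  proof (rule second_difference_mean_value[OF h, of x v u S \<phi>])
    fix s t assume "0 \<le> s" "s \<le> h" "0 \<le> t" "t \<le> h"
    then show "x + s *\<^sub>R v + t *\<^sub>R u \<in> S" using inS[of t s] by (simp add: add_ac)
  qed (auto intro: smooth_on_differentiable[OF \<phi>] smooth_on_differentiable[OF smooth_on_D[OF \<phi>]])
  have "h * h * a u v (x + s *\<^sub>R u + t *\<^sub>R v) = h * h * a v u (x + s' *\<^sub>R u + t' *\<^sub>R v)"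
    using st(5) st'(5) by (simp add: algebra_simps)
  then have eq: "a u v (x + s *\<^sub>R u + t *\<^sub>R v) = a v u (x + s' *\<^sub>R u + t' *\<^sub>R v)" using h by simp
  have "dist (a u v (x + s *\<^sub>R u + t *\<^sub>R v)) (a u v x) < \<bar>a u v x - a v u x\<bar> / 2"
    using near[of s t] st by (intro d1) (simp add: d_def)
  moreover have "dist (a v u (x + s' *\<^sub>R u + t' *\<^sub>R v)) (a v u x) < \<bar>a u v x - a v u x\<bar> / 2"
    using near[of s' t'] st' by (intro d2) (simp add: d_def)
  ultimately show False unfolding eq dist_real_def by (smt (verit) field_sum_of_halves)
qed

text \<open>Openness lets the values on \<open>S\<close> determine the derivatives, since
  \<open>D\<close> is taken in the whole space and not relative to \<open>S\<close>.\<close>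

lemma Ck_on_cong_open:
  assumes "open S" "\<And>x. x \<in> S \<Longrightarrow> h x = k x" "Ck_on n S h"
  shows "Ck_on n S k"
  using assms(2,3)
proof (induction n arbitrary: h k)
  case 0
  then show ?case using continuous_on_cong[of S S h k] by simp
next
  case (Suc n)
  have hk: "(k has_derivative D h x) (at x)" if "x \<in> S" for x
    by (rule has_derivative_transform_within_open[of h _ _ UNIV S])
      (use Suc that assms(1) in \<open>auto simp flip: frechet_derivative_works\<close>)
  then have D: "D h x v = D k x v" if "x \<in> S" for x v
    using frechet_derivativeI[OF hk[OF that]] by simp
  have "k differentiable (at x)" if "x \<in> S" for x
    using hk[OF that] by (auto simp: differentiable_def)
  then show ?case
    using Suc.IH[OF D] Suc.prems by simp
qed

lemma Ck_on_bounded_linear: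
  assumes "open S" "bounded_linear L" "Ck_on n S h"
  shows "Ck_on n S (\<lambda>x. L (h x))"
  using assms(3)
proof (induction n arbitrary: h)
  case 0
  then show ?case by (simp add: bounded_linear.continuous_on[OF assms(2)])
next
  case (Suc n)
  have d: "((\<lambda>x. L (h x)) has_derivative (\<lambda>v. L (D h x v))) (at x)" if "x \<in> S" for x
    using Suc.prems that by (intro bounded_linear.has_derivative[OF assms(2)]) (simp flip: frechet_derivative_works)
  have "Ck_on n S (\<lambda>x. D (\<lambda>x. L (h x)) x v)" for v
    by (rule Ck_on_cong_open[OF assms(1), of "\<lambda>x. L (D h x v)"])
      (use Suc frechet_derivativeI[OF d] in auto)
  then show ?case using d by (auto simp: differentiable_def)
qed

lemma smooth_on_bounded_linear:
  "open S \<Longrightarrow> bounded_linear L \<Longrightarrow> smooth_on S h \<Longrightarrow> smooth_on S (\<lambda>x. L (h x))"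
  unfolding smooth_on_def using Ck_on_bounded_linear by blast

lemma second_derivative_symmetric:
  fixes F :: "'a::real_normed_vector \<Rightarrow> 'b::euclidean_space"
  assumes S: "open S" "x \<in> S" and F: "smooth_on S F"
  shows "D (\<lambda>y. D F y u) x v = D (\<lambda>y. D F y v) x u"
proof (rule euclidean_eqI)
  fix b :: 'b assume "b \<in> Basis"
  have D1: "D (\<lambda>y. F y \<bullet> b) y w = D F y w \<bullet> b" if "y \<in> S" for y w
    using frechet_derivativeI[OF has_derivative_inner_left[OF smooth_on_has_derivative[OF F that], of b]] by simp
  have D2: "D (\<lambda>y. D (\<lambda>y. F y \<bullet> b) y w) x z = D (\<lambda>y. D F y w) x z \<bullet> b" for w z
  proof -
    have "((\<lambda>y. D (\<lambda>y. F y \<bullet> b) y w) has_derivative (\<lambda>z. D (\<lambda>y. D F y w) x z \<bullet> b)) (at x)"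
      by (rule has_derivative_transform_within_open[of "\<lambda>y. D F y w \<bullet> b" _ _ UNIV S])
        (use S D1 in \<open>auto intro!: has_derivative_inner_left smooth_on_has_derivative[OF smooth_on_D[OF F]]\<close>)
    from frechet_derivativeI[OF this] show ?thesis by simp
  qed
  show "D (\<lambda>y. D F y u) x v \<bullet> b = D (\<lambda>y. D F y v) x u \<bullet> b"
    using second_derivative_symmetric_real[OF S smooth_on_bounded_linear[OF S(1) bounded_linear_inner_left F, of b], of u v]
    by (simp add: D2)
qed

section \<open>Derivatives of families of linear maps and of linear systems\<close>

lemma linear_basis_expansion:
  fixes L :: "'a::euclidean_space \<Rightarrow> 'b::real_vector"
  assumes "linear L"
  shows "L v = (\<Sum>b\<in>Basis. (v \<bullet> b) *\<^sub>R L b)"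
proof -
  have "L (\<Sum>b\<in>Basis. (v \<bullet> b) *\<^sub>R b) = (\<Sum>b\<in>Basis. (v \<bullet> b) *\<^sub>R L b)"
    using assms by (simp add: linear_sum linear_scale)
  then show ?thesis by (simp add: euclidean_representation)
qed

text \<open>Expansion in a basis turns \<open>L y (s y)\<close> into a finite sum of products, so
  differentiability of \<open>L y v\<close> for each fixed \<open>v\<close> is enough for the
  product rule.\<close>

lemma has_derivative_linear_family:
  fixes L :: "'x::real_normed_vector \<Rightarrow> 'a::euclidean_space \<Rightarrow> 'b::real_normed_vector"
  assumes S: "open S" "x \<in> S" and lin: "\<And>y. y \<in> S \<Longrightarrow> linear (L y)"
    and L': "\<And>v. ((\<lambda>y. L y v) has_derivative L' v) (at x)"
    and s: "(s has_derivative s') (at x)"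
  shows "((\<lambda>y. L y (s y)) has_derivative (\<lambda>h. L' (s x) h + L x (s' h))) (at x)"
proof -
  \<comment> \<open>Linearity of \<open>L'\<close> in its first argument is not assumed; it is
    inherited from \<open>L y\<close> through uniqueness of derivatives.\<close>
  have "((\<lambda>y. L y v) has_derivative (\<lambda>h. \<Sum>b\<in>Basis. (v \<bullet> b) *\<^sub>R L' b h)) (at x)" for v
    by (rule has_derivative_transform_within_open[of "\<lambda>y. \<Sum>b\<in>Basis. (v \<bullet> b) *\<^sub>R L y b" _ _ UNIV S])
      (use S linear_basis_expansion[OF lin] in \<open>auto intro!: has_derivative_sum has_derivative_scaleR_right L'\<close>)
  then have eq: "L' v = (\<lambda>h. \<Sum>b\<in>Basis. (v \<bullet> b) *\<^sub>R L' b h)" for v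
    using has_derivative_unique[OF L'] by blast
  have "((\<lambda>y. L y (s y)) has_derivative
      (\<lambda>h. \<Sum>b\<in>Basis. (s x \<bullet> b) *\<^sub>R L' b h + (s' h \<bullet> b) *\<^sub>R L x b)) (at x)"
    by (rule has_derivative_transform_within_open[of "\<lambda>y. \<Sum>b\<in>Basis. (s y \<bullet> b) *\<^sub>R L y b" _ _ UNIV S])
      (use S linear_basis_expansion[OF lin, symmetric] in
        \<open>auto intro!: has_derivative_sum has_derivative_scaleR has_derivative_inner_left s L'\<close>)
  moreover have "(\<Sum>b\<in>Basis. (s x \<bullet> b) *\<^sub>R L' b h + (s' h \<bullet> b) *\<^sub>R L x b) =
      L' (s x) h + L x (s' h)" for h
    using eq[of "s x"] linear_basis_expansion[OF lin[OF S(2)], of "s' h"]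
    by (simp add: sum.distrib)
  ultimately show ?thesis by simp
qed

lemma has_derivative_bilinear_family:
  fixes \<beta> :: "'x::real_normed_vector \<Rightarrow> 'a::euclidean_space \<Rightarrow> 'b::euclidean_space \<Rightarrow> 'c::real_normed_vector"
  assumes S: "open S" "x \<in> S" and bil: "\<And>y. y \<in> S \<Longrightarrow> bilinear (\<beta> y)"
    and \<beta>': "\<And>u v. ((\<lambda>y. \<beta> y u v) has_derivative \<beta>' u v) (at x)"
    and a: "(a has_derivative a') (at x)" and b: "(b has_derivative b') (at x)"
  shows "((\<lambda>y. \<beta> y (a y) (b y)) has_derivative
    (\<lambda>h. \<beta>' (a x) (b x) h + \<beta> x (a' h) (b x) + \<beta> x (a x) (b' h))) (at x)"
proof (rule has_derivative_linear_family[where L = "\<lambda>y. \<beta> y (a y)", OF S _ _ b])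
  show "linear (\<beta> y (a y))" if "y \<in> S" for y
    using bil[OF that] by (simp add: bilinear_def)
  show "((\<lambda>y. \<beta> y (a y) v) has_derivative (\<lambda>h. \<beta>' (a x) v h + \<beta> x (a' h) v)) (at x)" for v
    by (rule has_derivative_linear_family[where L = "\<lambda>y u. \<beta> y u v", OF S _ \<beta>' a])
      (use bil in \<open>simp add: bilinear_def\<close>)
qed

lemma bounded_linear_axis: "bounded_linear (axis i :: 'a::real_normed_vector \<Rightarrow> 'a^'n::finite)"
proof (rule bounded_linear_intro[of _ 1])
  show "norm (axis i x :: 'a^'n) \<le> norm x * 1" for x :: 'a
    by (simp add: norm_vec_def L2_set_def axis_def if_distrib[of norm] if_distrib[of "\<lambda>t. t^2"] cong: if_cong)
qed (simp_all add: axis_def vec_eq_iff)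

lemma bounded_linear_differentiable:
  "bounded_linear L \<Longrightarrow> f differentiable (at x) \<Longrightarrow> (\<lambda>x. L (f x)) differentiable (at x)"
  unfolding differentiable_def using bounded_linear.has_derivative by blast

lemma vec_differentiable:
  fixes s :: "'x::real_normed_vector \<Rightarrow> 'a::real_normed_vector^'n::finite"
  assumes "\<And>i. (\<lambda>x. s x $ i) differentiable (at x)"
  shows "s differentiable (at x)"
proof -
  have "s = (\<lambda>x. \<Sum>i\<in>UNIV. axis i (s x $ i))"
    by (auto simp: fun_eq_iff vec_eq_iff axis_def if_distrib cong: if_cong)
  moreover have "(\<lambda>x. \<Sum>i\<in>UNIV. axis i (s x $ i) :: 'a^'n) differentiable (at x)"
    using bounded_linear_differentiable[OF bounded_linear_axis assms] by (intro differentiable_sum) auto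
  ultimately show ?thesis by simp
qed

lemma differentiable_prod:
  fixes f :: "'i \<Rightarrow> 'x::real_normed_vector \<Rightarrow> 'f::real_normed_field"
  assumes "finite I" "\<And>i. i \<in> I \<Longrightarrow> f i differentiable (at x)"
  shows "(\<lambda>x. \<Prod>i\<in>I. f i x) differentiable (at x)"
  using assms by (induction I) auto

lemma differentiable_det:
  fixes A :: "'x::real_normed_vector \<Rightarrow> 'f::real_normed_field^'n::finite^'n"
  assumes "\<And>i j. (\<lambda>y. A y $ i $ j) differentiable (at x)"
  shows "(\<lambda>y. det (A y)) differentiable (at x)"
  unfolding det_def using assms
  by (intro differentiable_sum differentiable_mult differentiable_prod ballI) auto

text \<open>Cramer's rule writes each component of the solution as a quotient of determinants. It
  applies to objects known only through a linear equation: the shape operator and the inverse Gram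
  matrix.\<close>

lemma differentiable_linear_solve:
  fixes A :: "'x::real_normed_vector \<Rightarrow> 'f::real_normed_field^'n::finite^'n"
  assumes S: "open S" "x \<in> S" and det: "\<And>y. y \<in> S \<Longrightarrow> det (A y) \<noteq> 0"
    and s: "\<And>y. y \<in> S \<Longrightarrow> A y *v s y = b y"
    and A: "\<And>i j. (\<lambda>y. A y $ i $ j) differentiable (at x)"
    and b: "\<And>i. (\<lambda>y. b y $ i) differentiable (at x)"
  shows "s differentiable (at x)"
proof (rule vec_differentiable)
  fix k
  let ?r = "\<lambda>y. det (\<chi> i j. if j = k then b y $ i else A y $ i $ j) / det (A y)"
  have "(\<lambda>y. det (\<chi> i j. if j = k then b y $ i else A y $ i $ j)) differentiable (at x)"
  proof (rule differentiable_det)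
    fix i j
    show "(\<lambda>y. (\<chi> i j. if j = k then b y $ i else A y $ i $ j) $ i $ j) differentiable (at x)"
      using A b by (cases "j = k") auto
  qed
  then have "?r differentiable (at x)"
    using differentiable_det[OF A] det[OF S(2)] by (intro differentiable_divide) auto
  then obtain r' where "(?r has_derivative r') (at x)" by (auto simp: differentiable_def)
  then have "((\<lambda>y. s y $ k) has_derivative r') (at x)"
  proof (rule has_derivative_transform_within_open[OF _ S])
    fix y assume y: "y \<in> S"
    show "?r y = s y $ k"
      using cramer[OF det[OF y], of "s y" "b y"] s[OF y] by (simp add: vec_eq_iff)
  qed
  then show "(\<lambda>y. s y $ k) differentiable (at x)" by (auto simp: differentiable_def)
qed

section \<open>The Codazzi equation\<close>

text \<open>A hypersurface read in one ambient chart. \<open>\<Gamma>\<close> is a parameter tied to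
  \<open>g\<close> by the Koszul identity, so that a closed form can be supplied and differentiated.
  The ambient conditions are imposed at every \<open>y\<close> because an affine chart takes all
  matrices as coordinates.\<close>

locale local_hypersurface =
  fixes g :: "'d::euclidean_space local_metric"
    and \<Gamma> :: "'d \<Rightarrow> 'd \<Rightarrow> 'd \<Rightarrow> 'd"
    and U :: "(real^'k::finite) set"
    and F n :: "real^'k \<Rightarrow> 'd"
  assumes g_bilinear: "bilinear (g y)"
    and g_sym: "g y u v = g y v u"
    and g_nondegenerate: "(\<And>z. g y w z = 0) \<Longrightarrow> w = 0"
    and g_differentiable: "(\<lambda>y. g y u v) differentiable (at y)"
    and koszul: "2 * g y (\<Gamma> y u v) z =
      D (\<lambda>y. g y v z) y u + D (\<lambda>y. g y u z) y v - D (\<lambda>y. g y u v) y z"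
    and \<Gamma>_bilinear: "bilinear (\<Gamma> y)"
    and \<Gamma>_differentiable: "(\<lambda>y. \<Gamma> y u v) differentiable (at y)"
    and U_open: "open U"
    and F_smooth: "smooth_on U F"
    and n_smooth: "smooth_on U n"
    and F_inj: "x \<in> U \<Longrightarrow> inj (D F x)"
    and n_unit: "x \<in> U \<Longrightarrow> g (F x) (n x) (n x) = 1"
    and n_normal: "x \<in> U \<Longrightarrow> g (F x) (n x) (D F x t) = 0"
    and codim1: "DIM('d) = CARD('k) + 1"
begin

lemmas g_simps = bilinear_ladd[OF g_bilinear] bilinear_radd[OF g_bilinear]
  bilinear_lsub[OF g_bilinear] bilinear_rsub[OF g_bilinear]
  bilinear_lmul[OF g_bilinear] bilinear_rmul[OF g_bilinear]
  bilinear_lneg[OF g_bilinear] bilinear_rneg[OF g_bilinear]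
  bilinear_lzero[OF g_bilinear] bilinear_rzero[OF g_bilinear]

lemmas F_derivative = smooth_on_has_derivative[OF F_smooth]
lemmas DF_derivative = smooth_on_has_derivative[OF smooth_on_D[OF F_smooth]]
lemmas n_derivative = smooth_on_has_derivative[OF n_smooth]
lemmas Dn_derivative = smooth_on_has_derivative[OF smooth_on_D[OF n_smooth]]

lemma DF_linear: "x \<in> U \<Longrightarrow> linear (D F x)"
  using has_derivative_linear[OF F_derivative] .

lemma g_eqI:
  assumes "\<And>z. g y v z = g y w z"
  shows "v = w"
  using g_nondegenerate[of y "v - w"] assms by (simp add: g_simps)

lemma christoffel_ambient: "christoffel g y u v = \<Gamma> y u v"
  unfolding christoffel_def
proof (rule the_equality)
  fix w
  assume "\<forall>z. 2 * g y w z = D (\<lambda>y. g y v z) y u + D (\<lambda>y. g y u z) y v - D (\<lambda>y. g y u v) y z"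
  then have "2 * g y w z = 2 * g y (\<Gamma> y u v) z" for z using koszul[of y u v z] by metis
  then show "w = \<Gamma> y u v" by (intro g_eqI[of y]) simp
qed (use koszul in blast)

text \<open>Dimension count: \<open>n x\<close> lies outside the hyperplane \<open>?H\<close>, so
  \<open>?H\<close> has dimension at most \<open>CARD('k)\<close>, which is already the dimension of
  the tangent space contained in it.\<close>

lemma tangentI:
  assumes x: "x \<in> U" and w: "g (F x) (n x) w = 0"
  shows "\<exists>v. D F x v = w"
proof -
  let ?H = "{w. g (F x) (n x) w = 0}"
  have H: "subspace ?H" by (auto simp: subspace_def g_simps)
  have T: "subspace (range (D F x))" by (rule linear_subspace_image[OF DF_linear[OF x] subspace_UNIV])
  have "n x \<notin> ?H" using n_unit[OF x] by simp
  then have "span ?H \<noteq> UNIV" using H by (metis UNIV_I span_eq_iff)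
  then have "dim ?H \<noteq> DIM('d)" using dim_eq_full by blast
  then have "dim ?H < DIM('d)" using dim_subset_UNIV[of ?H] by simp
  moreover have "dim (range (D F x)) = CARD('k)"
    using dim_image_eq[OF DF_linear[OF x], of UNIV] F_inj[OF x] by (simp add: inj_on_def)
  ultimately have "dim ?H \<le> dim (range (D F x))" using codim1 by simp
  moreover have "range (D F x) \<subseteq> ?H" using n_normal[OF x] by auto
  ultimately have "range (D F x) = ?H" using subspace_dim_equal[OF T H] by blast
  then have "w \<in> range (D F x)" using w by blast
  then show ?thesis by (metis imageE)
qed

lemma tangent_normal_decomposition:
  assumes "x \<in> U"
  obtains v where "w = D F x v + g (F x) (n x) w *\<^sub>R n x"
proof -
  have "g (F x) (n x) (w - g (F x) (n x) w *\<^sub>R n x) = 0"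
    by (simp add: g_simps n_unit[OF assms])
  from tangentI[OF assms this] obtain v where "D F x v = w - g (F x) (n x) w *\<^sub>R n x" by blast
  then show ?thesis using that[of v] by simp
qed

lemma g_along_derivative:
  assumes x: "x \<in> U" and a: "(a has_derivative a') (at x)" and b: "(b has_derivative b') (at x)"
  shows "((\<lambda>x. g (F x) (a x) (b x)) has_derivative
    (\<lambda>h. D (\<lambda>y. g y (a x) (b x)) (F x) (D F x h) + g (F x) (a' h) (b x) + g (F x) (a x) (b' h))) (at x)"
proof (rule has_derivative_bilinear_family[OF U_open x _ _ a b, where \<beta> = "\<lambda>x. g (F x)"])
  show "((\<lambda>x. g (F x) u v) has_derivative (\<lambda>h. D (\<lambda>y. g y u v) (F x) (D F x h))) (at x)" for u v
    by (rule has_derivative_compose[OF F_derivative[OF x], of "\<lambda>y. g y u v"])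
      (use g_differentiable in \<open>simp flip: frechet_derivative_works\<close>)
qed (rule g_bilinear)

text \<open>The local form of \<open>shape_operator\<close>, with the same definite description, so
  that the two coincide once the ambient metric of the chart is identified.\<close>

definition shape :: "real^'k \<Rightarrow> real^'k \<Rightarrow> real^'k" where
  "shape x u = (THE v. D F x v = - cov_deriv_along g F n x u)"

lemma cov_deriv_along_eq: "cov_deriv_along g F n x u = D n x u + \<Gamma> (F x) (D F x u) (n x)"
  by (simp add: cov_deriv_along_def christoffel_ambient)

lemma g_normal_cov_deriv:
  assumes x: "x \<in> U"
  shows "g (F x) (n x) (cov_deriv_along g F n x u) = 0"
proof -
  have "((\<lambda>x. g (F x) (n x) (n x)) has_derivative (\<lambda>h. 0)) (at x)"
    by (rule has_derivative_transform_within_open[of "\<lambda>_. 1" _ _ UNIV U])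
      (use U_open x n_unit in auto)
  from has_derivative_unique[OF this g_along_derivative[OF x n_derivative[OF x] n_derivative[OF x]]]
  have "0 = D (\<lambda>y. g y (n x) (n x)) (F x) (D F x u) + g (F x) (D n x u) (n x) + g (F x) (n x) (D n x u)"
    by meson
  \<comment> \<open>With \<open>n x\<close> in two slots, the last two Koszul terms cancel, leaving
    metric compatibility for the pair \<open>n x\<close>, \<open>n x\<close>.\<close>
  moreover have "2 * g (F x) (\<Gamma> (F x) (D F x u) (n x)) (n x) = D (\<lambda>y. g y (n x) (n x)) (F x) (D F x u)"
    using koszul[of "F x" "D F x u" "n x" "n x"] by simp
  ultimately show ?thesis
    using g_sym[of "F x" "n x"] by (simp add: cov_deriv_along_eq g_simps)
qed

lemma DF_shape:
  assumes x: "x \<in> U"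
  shows "D F x (shape x u) = - (D n x u + \<Gamma> (F x) (D F x u) (n x))"
proof -
  have "\<exists>v. D F x v = - cov_deriv_along g F n x u"
    by (rule tangentI[OF x]) (simp add: g_simps g_normal_cov_deriv[OF x])
  then have "\<exists>!v. D F x v = - cov_deriv_along g F n x u"
    using F_inj[OF x] by (metis injD)
  from theI'[OF this] show ?thesis unfolding shape_def cov_deriv_along_eq .
qed

lemma \<Gamma>_along_derivative:
  assumes x: "x \<in> U" and a: "(a has_derivative a') (at x)" and b: "(b has_derivative b') (at x)"
  shows "((\<lambda>x. \<Gamma> (F x) (a x) (b x)) has_derivative
    (\<lambda>h. D (\<lambda>y. \<Gamma> y (a x) (b x)) (F x) (D F x h) + \<Gamma> (F x) (a' h) (b x) + \<Gamma> (F x) (a x) (b' h))) (at x)"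
proof (rule has_derivative_bilinear_family[OF U_open x _ _ a b, where \<beta> = "\<lambda>x. \<Gamma> (F x)"])
  show "((\<lambda>x. \<Gamma> (F x) u v) has_derivative (\<lambda>h. D (\<lambda>y. \<Gamma> y u v) (F x) (D F x h))) (at x)" for u v
    by (rule has_derivative_compose[OF F_derivative[OF x], of "\<lambda>y. \<Gamma> y u v"])
      (use \<Gamma>_differentiable in \<open>simp flip: frechet_derivative_works\<close>)
qed (rule \<Gamma>_bilinear)

text \<open>The equation \<open>DF_shape\<close> is overdetermined by one dimension. A left inverse
  \<open>P\<close> of \<open>D F x\<close>, frozen at the single point \<open>x\<close>, makes it a
  square system with matrix \<open>P \<circ> D F y\<close>. This is the identity at
  \<open>y = x\<close>, hence invertible on a neighbourhood.\<close>

lemma shape_differentiable: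
  assumes x: "x \<in> U"
  shows "(\<lambda>x. shape x w) differentiable (at x)"
proof -
  obtain P where P: "linear P" "P \<circ> D F x = id"
    using linear_injective_left_inverse[OF DF_linear[OF x] F_inj[OF x]] by blast
  have P_deriv: "(\<lambda>y. P (k y) $ i) differentiable (at y)" if "k differentiable (at y)" for k y i
  proof -
    have "(\<lambda>y. P (k y)) differentiable (at y)"
      using bounded_linear_differentiable[OF _ that] P(1) linear_conv_bounded_linear by blast
    then show ?thesis using bounded_linear_differentiable[OF bounded_linear_vec_nth] by blast
  qed
  define A where "A y = (matrix (\<lambda>v. P (D F y v)))" for y
  have A: "A y *v v = P (D F y v)" if "y \<in> U" for y v
    unfolding A_def
    using matrix_works[of "P \<circ> D F y" v] linear_compose[OF DF_linear[OF that] P(1)]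
    by (simp add: o_def)
  have A_entry: "A y $ i $ j = P (D F y (axis j 1)) $ i" for y i j
    by (simp add: A_def matrix_def)
  have A_diff: "(\<lambda>y. A y $ i $ j) differentiable (at y)" if "y \<in> U" for y i j
    unfolding A_entry
    by (intro P_deriv smooth_on_differentiable[OF smooth_on_D[OF F_smooth]] that)
  have "A x = mat 1"
    using P(2) A[OF x] by (simp add: matrix_eq fun_eq_iff)
  then have det_x: "det (A x) \<noteq> 0" by simp
  let ?S = "{y \<in> U. det (A y) \<noteq> 0}"
  have "continuous_on U (\<lambda>y. det (A y))"
    using differentiable_det[OF A_diff]
    by (intro continuous_at_imp_continuous_on) (auto intro: differentiable_imp_continuous_within)
  then have "open (U \<inter> (\<lambda>y. det (A y)) -` (- {0}))"
    using U_open by (intro continuous_open_preimage) auto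
  moreover have "U \<inter> (\<lambda>y. det (A y)) -` (- {0}) = ?S" by auto
  ultimately have S_open: "open ?S" by simp
  let ?b = "\<lambda>y. - (D n y w + \<Gamma> (F y) (D F y w) (n y))"
  have "(\<lambda>y. \<Gamma> (F y) (D F y w) (n y)) differentiable (at x)"
    using \<Gamma>_along_derivative[OF x DF_derivative[OF x] n_derivative[OF x]] unfolding differentiable_def by blast
  then have b: "?b differentiable (at x)"
    using smooth_on_differentiable[OF smooth_on_D[OF n_smooth] x]
    by (intro differentiable_minus differentiable_add)
  show ?thesis
    by (rule differentiable_linear_solve[OF S_open, of x A _ "\<lambda>y. P (?b y)"])
      (use x det_x A DF_shape A_diff P_deriv[OF b] in auto)
qed

lemma christoffel_pullback_commute:
  "christoffel (pullback_metric g F) x u v = christoffel (pullback_metric g F) x v u"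
proof -
  have "(\<lambda>x. pullback_metric g F x u v) = (\<lambda>x. pullback_metric g F x v u)"
    by (simp add: pullback_metric_def g_sym)
  then show ?thesis unfolding christoffel_def by (simp add: add.commute)
qed

section \<open>The Codazzi equation at a point where the ambient metric is constant to first
  order\<close>

context
  fixes x assumes x: "x \<in> U" and flat: "\<And>u v h. D (\<lambda>y. g y u v) (F x) h = 0"
begin

lemma \<Gamma>_zero: "\<Gamma> (F x) u v = 0"
  by (rule g_nondegenerate[of "F x"]) (use koszul[of "F x" u v] flat in simp)

text \<open>The Gauss formula: where \<open>\<Gamma>\<close> vanishes, the ambient covariant
  derivative of a coordinate field is a plain second derivative of \<open>F\<close>, and the induced
  connection is its tangential part.\<close>

lemma DF_christoffel:
  obtains \<mu> where "D F x (christoffel (pullback_metric g F) x u w) =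
    D (\<lambda>x. D F x w) x u + \<mu> *\<^sub>R n x"
proof -
  let ?D2 = "\<lambda>u w. D (\<lambda>x. D F x w) x u"
  have Dh: "D (\<lambda>x. pullback_metric g F x a b) x c =
      g (F x) (?D2 c a) (D F x b) + g (F x) (D F x a) (?D2 c b)" for a b c
    unfolding pullback_metric_def
    using frechet_derivativeI[OF g_along_derivative[OF x DF_derivative[OF x] DF_derivative[OF x], of a b]]
    by (simp add: flat)
  have sym: "?D2 a b = ?D2 b a" for a b
    using second_derivative_symmetric[OF U_open x F_smooth] .
  \<comment> \<open>The product rule gives six terms; symmetry of second derivatives cancels four
    and merges the other two.\<close>
  have rhs: "D (\<lambda>y. pullback_metric g F y w z) x u + D (\<lambda>y. pullback_metric g F y u z) x w -
      D (\<lambda>y. pullback_metric g F y u w) x z = 2 * g (F x) (?D2 u w) (D F x z)" for z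
    unfolding Dh sym[of w u] sym[of z u] sym[of z w] g_sym[of "F x" "D F x w"] by simp
  obtain v where v: "?D2 u w = D F x v + g (F x) (n x) (?D2 u w) *\<^sub>R n x"
    using tangent_normal_decomposition[OF x] .
  have "christoffel (pullback_metric g F) x u w = v"
    unfolding christoffel_def rhs
  proof (rule the_equality)
    have "g (F x) (D F x v) (D F x z) = g (F x) (?D2 u w) (D F x z)" for z
      by (subst v) (simp add: g_simps n_normal[OF x])
    then show *: "\<forall>z. 2 * pullback_metric g F x v z = 2 * g (F x) (?D2 u w) (D F x z)"
      by (simp add: pullback_metric_def)
    fix v' assume v': "\<forall>z. 2 * pullback_metric g F x v' z = 2 * g (F x) (?D2 u w) (D F x z)"
    have "D F x v' = D F x v"
    \<comment> \<open>The hypothesis tests only against tangent vectors; a general \<open>z\<close>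
      reduces to one because its normal part is orthogonal to the image of
      \<open>D F x\<close>.\<close>
    proof (rule g_eqI)
      fix z
      obtain t where t: "z = D F x t + g (F x) (n x) z *\<^sub>R n x"
        using tangent_normal_decomposition[OF x] .
      have "g (F x) (D F x a) (n x) = 0" for a
        using n_normal[OF x] g_sym by metis
      then show "g (F x) (D F x v') z = g (F x) (D F x v) z"
        using * v' by (subst (1 2) t) (simp add: g_simps pullback_metric_def)
    qed
    then show "v' = v" using F_inj[OF x] by (rule injD[rotated])
  qed
  then have "D F x (christoffel (pullback_metric g F) x u w) =
      ?D2 u w + (- g (F x) (n x) (?D2 u w)) *\<^sub>R n x"
    using v by (simp add: algebra_simps)
  then show ?thesis by (rule that)
qed

text \<open>Since \<open>\<Gamma>\<close> vanishes at \<open>F x\<close>, the difference of its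
  derivatives is the curvature R(X,Y) applied to \<open>n x\<close>, with X =
  \<open>D F x w\<close>, Y = \<open>D F x u\<close> and R(X,Y) the commutator of covariant
  derivatives.\<close>

theorem codazzi:
  obtains \<mu> where "D F x (cov_deriv_endo (pullback_metric g F) shape x u w -
      cov_deriv_endo (pullback_metric g F) shape x w u) =
    D (\<lambda>y. \<Gamma> y (D F x u) (n x)) (F x) (D F x w) - D (\<lambda>y. \<Gamma> y (D F x w) (n x)) (F x) (D F x u) +
    \<mu> *\<^sub>R n x"
proof -
  let ?h = "pullback_metric g F"
  let ?D2 = "\<lambda>u w. D (\<lambda>x. D F x w) x u"
  \<comment> \<open>One function, \<open>D F x (shape x w)\<close>, is differentiated in two ways:
    by the product rule and through \<open>DF_shape\<close>. In the second, terms that differentiate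
    an argument of \<open>\<Gamma>\<close> vanish by \<open>\<Gamma>_zero\<close>.\<close>
  have deriv: "?D2 u (shape x w) + D F x (D (\<lambda>x. shape x w) x u) =
      - (D (\<lambda>x. D n x w) x u + D (\<lambda>y. \<Gamma> y (D F x w) (n x)) (F x) (D F x u))" for u w
  proof -
    have 1: "((\<lambda>x. D F x (shape x w)) has_derivative
        (\<lambda>u. ?D2 u (shape x w) + D F x (D (\<lambda>x. shape x w) x u))) (at x)"
      by (rule has_derivative_linear_family[OF U_open x DF_linear DF_derivative[OF x]])
        (use shape_differentiable[OF x] in \<open>simp_all flip: frechet_derivative_works\<close>)
    have "((\<lambda>x. - (D n x w + \<Gamma> (F x) (D F x w) (n x))) has_derivative
        (\<lambda>u. - (D (\<lambda>x. D n x w) x u + D (\<lambda>y. \<Gamma> y (D F x w) (n x)) (F x) (D F x u)))) (at x)"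
      using has_derivative_minus[OF has_derivative_add[OF Dn_derivative[OF x]
        \<Gamma>_along_derivative[OF x DF_derivative[OF x] n_derivative[OF x]]], of w w]
      by (simp add: \<Gamma>_zero)
    then have "((\<lambda>x. D F x (shape x w)) has_derivative
        (\<lambda>u. - (D (\<lambda>x. D n x w) x u + D (\<lambda>y. \<Gamma> y (D F x w) (n x)) (F x) (D F x u)))) (at x)"
      by (rule has_derivative_transform_within_open[OF _ U_open x]) (simp add: DF_shape)
    from has_derivative_unique[OF 1 this] show ?thesis by meson
  qed
  obtain \<mu>1 where \<mu>1: "D F x (christoffel ?h x u (shape x w)) = ?D2 u (shape x w) + \<mu>1 *\<^sub>R n x"
    using DF_christoffel .
  obtain \<mu>2 where \<mu>2: "D F x (christoffel ?h x w (shape x u)) = ?D2 w (shape x u) + \<mu>2 *\<^sub>R n x"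
    using DF_christoffel .
  have n_sym: "D (\<lambda>x. D n x w) x u = D (\<lambda>x. D n x u) x w"
    using second_derivative_symmetric[OF U_open x n_smooth] .
  \<comment> \<open>The third term of \<open>cov_deriv_endo\<close> is symmetric in \<open>u\<close>
    and \<open>w\<close>, so it drops out here.\<close>
  have "cov_deriv_endo ?h shape x u w - cov_deriv_endo ?h shape x w u =
      (D (\<lambda>x. shape x w) x u + christoffel ?h x u (shape x w)) -
      (D (\<lambda>x. shape x u) x w + christoffel ?h x w (shape x u))"
    by (simp add: cov_deriv_endo_def christoffel_pullback_commute[of x u w])
  then have "D F x (cov_deriv_endo ?h shape x u w - cov_deriv_endo ?h shape x w u) =
      (?D2 u (shape x w) + D F x (D (\<lambda>x. shape x w) x u) + \<mu>1 *\<^sub>R n x) -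
      (?D2 w (shape x u) + D F x (D (\<lambda>x. shape x u) x w) + \<mu>2 *\<^sub>R n x)"
    by (simp add: linear_add[OF DF_linear[OF x]] linear_diff[OF DF_linear[OF x]] \<mu>1 \<mu>2)
  also have "\<dots> = D (\<lambda>y. \<Gamma> y (D F x u) (n x)) (F x) (D F x w) -
      D (\<lambda>y. \<Gamma> y (D F x w) (n x)) (F x) (D F x u) + (\<mu>1 - \<mu>2) *\<^sub>R n x"
    unfolding deriv n_sym by (simp add: algebra_simps)
  finally show ?thesis using that by blast
qed

end

end

section \<open>The metric of the Grassmannian in affine coordinates\<close>

abbreviation adj :: "complex^'n^'l \<Rightarrow> complex^'l^'n" where
  "adj \<equiv> adjoint_matrix"

lemma adj_nth [simp]: "adj X $ i $ j = cnj (X $ j $ i)"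
  by (simp add: adjoint_matrix_def)

lemma adj_adj [simp]: "adj (adj X) = X"
  by (simp add: vec_eq_iff)

lemma adj_add: "adj (X + Y) = adj X + adj Y"
  by (simp add: vec_eq_iff)

lemma adj_diff: "adj (X - Y) = adj X - adj Y"
  by (simp add: vec_eq_iff)

lemma adj_minus: "adj (- X) = - adj X"
  by (simp add: vec_eq_iff)

lemma adj_zero [simp]: "adj 0 = 0"
  by (simp add: vec_eq_iff)

lemma adj_one [simp]: "adj (mat 1) = mat 1"
  by (simp add: vec_eq_iff mat_def)

lemma adj_scaleR: "adj (r *\<^sub>R X) = r *\<^sub>R adj X"
  by (simp add: vec_eq_iff)

lemma adj_mult: "adj (X ** Y) = adj Y ** adj X"
  by (simp add: vec_eq_iff matrix_matrix_mult_def mult.commute)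

lemma bounded_linear_adj: "bounded_linear (adj :: complex^'n::finite^'l::finite \<Rightarrow> _)"
  unfolding linear_conv_bounded_linear[symmetric]
  by (intro linearI) (simp_all add: adj_add adj_scaleR)

lemma bounded_bilinear_matrix_mult:
  "bounded_bilinear ((**) :: complex^'n::finite^'l::finite \<Rightarrow> complex^'p::finite^'n \<Rightarrow> complex^'p^'l)"
  unfolding bilinear_conv_bounded_bilinear[symmetric] bilinear_def
  by (auto intro!: linearI simp: vec_eq_iff
      matrix_matrix_mult_def scaleR_sum_right sum.distrib algebra_simps)

interpretation matmul: bounded_bilinear
  "(**) :: complex^'n::finite^'l::finite \<Rightarrow> complex^'p::finite^'n \<Rightarrow> complex^'p^'l"
  by (rule bounded_bilinear_matrix_mult)

lemmas matrix_ring_simps =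
  matmul.add_left matmul.add_right matmul.diff_left matmul.diff_right
  matmul.minus_left matmul.minus_right matmul.zero_left matmul.zero_right
  matmul.scaleR_left matmul.scaleR_right
  adj_add adj_diff adj_minus adj_scaleR adj_mult matrix_mul_assoc[symmetric]

definition retrace :: "complex^'n::finite^'n \<Rightarrow> real" where
  "retrace X = Re (trace X)"

lemma retrace_commute: "retrace (X ** Y) = retrace (Y ** X)"
  by (simp add: retrace_def trace_mul_sym[of X Y])

lemma retrace_adj: "retrace (adj X) = retrace X"
  by (simp add: retrace_def trace_def)

lemma bounded_linear_retrace: "bounded_linear retrace"
  unfolding linear_conv_bounded_linear[symmetric]
  by (intro linearI) (simp_all add: retrace_def trace_def sum.distrib sum_distrib_left)

lemmas retrace_simps =
  linear_add[OF bounded_linear.linear[OF bounded_linear_retrace]]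
  linear_diff[OF bounded_linear.linear[OF bounded_linear_retrace]]
  linear_neg[OF bounded_linear.linear[OF bounded_linear_retrace]]
  linear_scale[OF bounded_linear.linear[OF bounded_linear_retrace]]

lemma inner_complex: "x \<bullet> y = Re (cnj x * y)" for x y :: complex
  by (simp add: inner_complex_def)

lemma retrace_adj_mult: "retrace (adj X ** Y) = X \<bullet> Y"
proof -
  have "retrace (adj X ** Y) = (\<Sum>j\<in>UNIV. \<Sum>i\<in>UNIV. X $ i $ j \<bullet> Y $ i $ j)"
    by (simp add: retrace_def trace_def matrix_matrix_mult_def inner_complex)
  also have "\<dots> = (\<Sum>i\<in>UNIV. \<Sum>j\<in>UNIV. X $ i $ j \<bullet> Y $ i $ j)" by (rule sum.swap)
  finally show ?thesis by (simp add: inner_vec_def)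
qed

lemma inner_adj_vector: "(adj X *v w) \<bullet> z = w \<bullet> (X *v z)" for z :: "complex^'n::finite"
proof -
  have "(adj X *v w) \<bullet> z = (\<Sum>i\<in>UNIV. \<Sum>j\<in>UNIV. Re (X $ j $ i * cnj (w $ j) * z $ i))"
    by (simp only: inner_vec_def inner_complex matrix_vector_mult_def vec_lambda_beta cnj_sum
        sum_distrib_right Re_sum adj_nth complex_cnj_mult complex_cnj_cnj)
  also have "\<dots> = (\<Sum>j\<in>UNIV. \<Sum>i\<in>UNIV. Re (X $ j $ i * cnj (w $ j) * z $ i))" by (rule sum.swap)
  also have "\<dots> = w \<bullet> (X *v z)"
    by (simp only: inner_vec_def inner_complex matrix_vector_mult_def vec_lambda_beta
        sum_distrib_left Re_sum mult_ac)
  finally show ?thesis .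
qed

text \<open>The Gram matrix of the basis of the graph of \<open>y\<close> formed by the columns of
  \<open>stack y\<close>.\<close>

definition gram :: "complex^2^'m::finite \<Rightarrow> complex^2^2" where
  "gram y = mat 1 + adj y ** y"

definition gram_inv :: "complex^2^'m::finite \<Rightarrow> complex^2^2" where
  "gram_inv y = matrix_inv (gram y)"

lemma adj_gram: "adj (gram y) = gram y"
  by (simp add: gram_def matrix_ring_simps)

text \<open>Positive definiteness: pairing \<open>gram y *v z\<close> with \<open>z\<close> gives
  the squared norm of \<open>z\<close> plus that of \<open>y *v z\<close>.\<close>

lemma gram_invertible: "invertible (gram y)"
  unfolding invertible_left_inverse matrix_left_invertible_ker
proof (intro allI impI)
  fix z assume z: "gram y *v z = 0"
  have "z \<bullet> z \<le> z \<bullet> z + (y *v z) \<bullet> (y *v z)" by simp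
  also have "\<dots> = (gram y *v z) \<bullet> z"
    by (simp add: gram_def matrix_vector_mult_add_rdistrib inner_add_left inner_adj_vector
        flip: matrix_vector_mul_assoc)
  finally have "z \<bullet> z \<le> 0" using z by simp
  then show "z = 0" by (metis inner_eq_zero_iff inner_ge_zero order_antisym)
qed

lemma gram_inv_right [simp]: "gram y ** gram_inv y = mat 1"
  and gram_inv_left [simp]: "gram_inv y ** gram y = mat 1"
  using someI_ex[OF gram_invertible[of y, unfolded invertible_def]]
  by (simp_all add: gram_inv_def matrix_inv_def)

lemma adj_gram_inv [simp]: "adj (gram_inv y) = gram_inv y"
proof -
  have "adj (gram_inv y) = adj (gram_inv y) ** (gram y ** gram_inv y)" by simp
  also have "\<dots> = adj (gram y ** gram_inv y) ** gram_inv y"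
    unfolding matrix_mul_assoc adj_mult adj_gram ..
  finally show ?thesis by simp
qed

lemma gram_inv_zero [simp]: "gram_inv 0 = mat 1"
  using gram_inv_left[of 0] by (simp add: gram_def)

lemma adj_derivative: "(adj has_derivative adj) (at y)"
  by (rule bounded_linear_imp_has_derivative[OF bounded_linear_adj])

lemma gram_derivative: "(gram has_derivative (\<lambda>u. adj u ** y + adj y ** u)) (at y)"
proof -
  have "((\<lambda>y. mat 1 + adj y ** y) has_derivative (\<lambda>u. 0 + (adj y ** u + adj u ** y))) (at y)"
    by (intro has_derivative_add has_derivative_const matmul.FDERIV adj_derivative has_derivative_ident)
  then show ?thesis by (simp add: gram_def[abs_def] add.commute)
qed

text \<open>Column by column: \<open>gram_inv y *v axis j 1\<close> solves a linear system with
  differentiable matrix \<open>gram y\<close> and constant right-hand side.\<close>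

lemma gram_inv_differentiable: "gram_inv differentiable (at y)"
proof -
  have entry: "(\<lambda>y. gram y $ i $ j) differentiable (at y)" for i j
    using bounded_linear_differentiable[OF bounded_linear_vec_nth
        bounded_linear_differentiable[OF bounded_linear_vec_nth]] gram_derivative
    unfolding differentiable_def by blast
  have "(\<lambda>y. gram_inv y *v axis j 1) differentiable (at y)" for j
  proof (rule differentiable_linear_solve[of UNIV y gram _ "\<lambda>_. axis j 1"])
    show "det (gram y) \<noteq> 0" for y :: "complex^2^'a"
      using gram_invertible invertible_det_nz by blast
    show "gram y *v (gram_inv y *v axis j 1) = axis j 1" for y :: "complex^2^'a"
      by (simp add: matrix_vector_mul_assoc)
  qed (use entry in auto)
  then have "(\<lambda>y. (gram_inv y *v axis j 1) $ i) differentiable (at y)" for i j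
    by (rule bounded_linear_differentiable[OF bounded_linear_vec_nth])
  then have "(\<lambda>y. gram_inv y $ i $ j) differentiable (at y)" for i j
    by (simp add: matrix_vector_mult_def axis_def if_distrib cong: if_cong)
  then show ?thesis by (intro vec_differentiable)
qed

lemma gram_inv_derivative:
  "(gram_inv has_derivative (\<lambda>u. - (gram_inv y ** (adj u ** y + adj y ** u) ** gram_inv y))) (at y)"
proof -
  let ?M' = "D gram_inv y"
  have M': "(gram_inv has_derivative ?M') (at y)"
    using gram_inv_differentiable by (simp flip: frechet_derivative_works)
  have "((\<lambda>y. gram y ** gram_inv y) has_derivative
      (\<lambda>u. gram y ** ?M' u + (adj u ** y + adj y ** u) ** gram_inv y)) (at y)"
    by (rule matmul.FDERIV[OF gram_derivative M'])
  then have "((\<lambda>y::complex^2^'a. mat 1 :: complex^2^2) has_derivative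
      (\<lambda>u. gram y ** ?M' u + (adj u ** y + adj y ** u) ** gram_inv y)) (at y)"
    by simp
  from has_derivative_unique[OF this has_derivative_const]
  have 0: "gram y ** ?M' u + (adj u ** y + adj y ** u) ** gram_inv y = 0" for u by meson
  have "?M' u = - (gram_inv y ** (adj u ** y + adj y ** u) ** gram_inv y)" for u
  proof -
    have "gram y ** ?M' u = - ((adj u ** y + adj y ** u) ** gram_inv y)"
      using 0[of u] by (simp add: add_eq_0_iff2)
    then have "gram_inv y ** (gram y ** ?M' u) = gram_inv y ** - ((adj u ** y + adj y ** u) ** gram_inv y)"
      by simp
    then show ?thesis
      unfolding matrix_mul_assoc gram_inv_left by (simp add: matmul.minus_right matrix_mul_assoc)
  qed
  then show ?thesis by (intro has_derivative_eq_rhs[OF M'] ext)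
qed

text \<open>The inverse of \<open>mat 1 + y ** adj y\<close>, written in Woodbury form so that only
  the inverse of a 2 by 2 matrix has to be differentiated. The projector computation produces it in
  this form.\<close>

definition cogram_inv :: "complex^2^'m::finite \<Rightarrow> complex^'m^'m" where
  "cogram_inv y = mat 1 - y ** gram_inv y ** adj y"

lemma adj_cogram_inv [simp]: "adj (cogram_inv y) = cogram_inv y"
  by (simp add: cogram_inv_def matrix_ring_simps)

lemma cogram_inv_zero [simp]: "cogram_inv 0 = mat 1"
  by (simp add: cogram_inv_def matrix_ring_simps)

lemma cogram_inv_right: "cogram_inv y ** (mat 1 + y ** adj y) = mat 1"
proof -
  have "cogram_inv y ** (mat 1 + y ** adj y) =
      mat 1 + y ** adj y - y ** gram_inv y ** gram y ** adj y"
    by (simp add: cogram_inv_def gram_def matrix_ring_simps)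
  also have "y ** gram_inv y ** gram y ** adj y = y ** adj y"
    by (simp flip: matrix_mul_assoc add: matrix_mul_assoc[of "gram_inv y"])
  finally show ?thesis by simp
qed

lemma cogram_inv_derivative:
  "(cogram_inv has_derivative
    (\<lambda>u. - (cogram_inv y ** u ** gram_inv y ** adj y + y ** gram_inv y ** adj u ** cogram_inv y))) (at y)"
proof -
  have "(cogram_inv has_derivative (\<lambda>u. 0 - (y ** gram_inv y ** adj u +
      (y ** - (gram_inv y ** (adj u ** y + adj y ** u) ** gram_inv y) + u ** gram_inv y) ** adj y))) (at y)"
    unfolding cogram_inv_def[abs_def]
    by (intro has_derivative_diff has_derivative_const matmul.FDERIV adj_derivative has_derivative_ident
        gram_inv_derivative)
  moreover have "0 - (y ** gram_inv y ** adj u +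
      (y ** - (gram_inv y ** (adj u ** y + adj y ** u) ** gram_inv y) + u ** gram_inv y) ** adj y) =
    - (cogram_inv y ** u ** gram_inv y ** adj y + y ** gram_inv y ** adj u ** cogram_inv y)" for u
    by (simp add: cogram_inv_def matrix_ring_simps)
  ultimately show ?thesis by simp
qed

text \<open>The analogue of the Fubini-Study metric in graph coordinates, weighted by the inverses
  of \<open>mat 1 + adj y ** y\<close> and \<open>mat 1 + y ** adj y\<close>.\<close>

definition affine_metric :: "(complex^2^'m::finite) local_metric" where
  "affine_metric y u v = retrace (gram_inv y ** adj u ** cogram_inv y ** v) / 2"

text \<open>The metric is Kaehler, so its Levi-Civita connection is the Chern connection: the
  formula is read off from the part of the derivative of the Hermitian form that is complex linear
  in the direction.\<close>

definition affine_christoffel :: "complex^2^'m::finite \<Rightarrow> complex^2^'m \<Rightarrow> complex^2^'m \<Rightarrow> complex^2^'m" where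
  "affine_christoffel y u v = - (u ** gram_inv y ** adj y ** v + v ** gram_inv y ** adj y ** u)"

lemma affine_metric_zero: "affine_metric 0 u v = (u \<bullet> v) / 2"
  by (simp add: affine_metric_def retrace_adj_mult)

lemma affine_metric_derivative:
  "((\<lambda>y. affine_metric y u v) has_derivative (\<lambda>w.
    - (retrace (gram_inv y ** adj w ** y ** gram_inv y ** adj u ** cogram_inv y ** v) +
       retrace (gram_inv y ** adj y ** w ** gram_inv y ** adj u ** cogram_inv y ** v) +
       retrace (gram_inv y ** adj u ** cogram_inv y ** w ** gram_inv y ** adj y ** v) +
       retrace (gram_inv y ** adj u ** y ** gram_inv y ** adj w ** cogram_inv y ** v)) / 2)) (at y)"
proof -
  have "((\<lambda>y. affine_metric y u v) has_derivative (\<lambda>w.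
      retrace (gram_inv y ** adj u ** cogram_inv y ** 0 +
        (gram_inv y ** adj u ** - (cogram_inv y ** w ** gram_inv y ** adj y +
           y ** gram_inv y ** adj w ** cogram_inv y) +
         (gram_inv y ** 0 + - (gram_inv y ** (adj w ** y + adj y ** w) ** gram_inv y) ** adj u) **
         cogram_inv y) ** v) / 2)) (at y)"
    unfolding affine_metric_def
    by (intro bounded_linear.has_derivative[OF bounded_linear_divide]
        bounded_linear.has_derivative[OF bounded_linear_retrace] matmul.FDERIV
        gram_inv_derivative cogram_inv_derivative has_derivative_const)
  then show ?thesis
    by (rule has_derivative_eq_rhs)
      (simp add: fun_eq_iff matrix_ring_simps retrace_simps)
qed

text \<open>Each metric derivative consists of four traces of the shapes \<open>p\<close>,
  \<open>q\<close>, \<open>r\<close>. Cyclicity and invariance under adjoints identify the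
  \<open>p\<close> and \<open>r\<close> terms of the two positive derivatives with the four terms of
  the negative one; only \<open>q\<close> terms survive.\<close>

lemma affine_koszul:
  "2 * affine_metric y (affine_christoffel y u v) z =
    D (\<lambda>y. affine_metric y v z) y u + D (\<lambda>y. affine_metric y u z) y v - D (\<lambda>y. affine_metric y u v) y z"
proof -
  let ?M = "gram_inv y" and ?Q = "cogram_inv y"
  define p where "p a b c = retrace (?M ** adj y ** a ** ?M ** adj b ** ?Q ** c)" for a b c
  define q where "q a b c = retrace (?M ** adj a ** y ** ?M ** adj b ** ?Q ** c)" for a b c
  define r where "r a b c = retrace (?M ** adj b ** ?Q ** a ** ?M ** adj y ** c)" for a b c
  have pr: "p a b c = r c b a" for a b c
    unfolding p_def r_def
    using retrace_commute[of "?M ** adj y ** a" "?M ** adj b ** ?Q ** c"] by (simp add: matrix_mul_assoc)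
  have qr: "q a b c = r b c a" for a b c
  proof -
    have "q a b c = retrace (adj (?M ** adj a ** y ** ?M ** adj b ** ?Q ** c))"
      by (simp add: q_def retrace_adj)
    also have "\<dots> = retrace ((adj c ** ?Q ** b ** ?M ** adj y ** a) ** ?M)"
      by (simp add: matrix_ring_simps)
    also have "\<dots> = r b c a"
      by (subst retrace_commute) (simp add: r_def matrix_mul_assoc)
    finally show ?thesis .
  qed
  have D: "D (\<lambda>y. affine_metric y b c) y a = - (q a b c + p a b c + r a b c + q b a c) / 2" for a b c
    using frechet_derivativeI[OF affine_metric_derivative[of b c y]] by (simp add: p_def q_def r_def)
  have "2 * affine_metric y (affine_christoffel y u v) z = - (q v u z + q u v z)"
    by (simp add: affine_metric_def affine_christoffel_def q_def matrix_ring_simps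
        retrace_simps)
  then show ?thesis
    unfolding D using pr[of z u v] pr[of v u z] qr[of z u v] qr[of u z v] pr[of u v z]
    by (simp add: field_simps)
qed

lemma affine_christoffel_derivative:
  "((\<lambda>y. affine_christoffel y b c) has_derivative (\<lambda>a.
    - (b ** (gram_inv y ** adj a - gram_inv y ** (adj a ** y + adj y ** a) ** gram_inv y ** adj y) ** c +
       c ** (gram_inv y ** adj a - gram_inv y ** (adj a ** y + adj y ** a) ** gram_inv y ** adj y) ** b))) (at y)"
proof -
  have "((\<lambda>y. b ** (gram_inv y ** adj y) ** c) has_derivative (\<lambda>a. b ** (gram_inv y ** adj y) ** 0 +
      (b ** (gram_inv y ** adj a + - (gram_inv y ** (adj a ** y + adj y ** a) ** gram_inv y) ** adj y) +
       0 ** (gram_inv y ** adj y)) ** c)) (at y)" for b c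
    by (intro matmul.FDERIV gram_inv_derivative adj_derivative has_derivative_const)
  note deriv = has_derivative_minus[OF has_derivative_add[OF this this], of b c c b]
  have "(\<lambda>y. affine_christoffel y b c) =
      (\<lambda>y. - (b ** (gram_inv y ** adj y) ** c + c ** (gram_inv y ** adj y) ** b))"
    by (simp add: affine_christoffel_def fun_eq_iff matrix_mul_assoc)
  then show ?thesis
    by (simp only:) (rule has_derivative_eq_rhs[OF deriv], simp add: fun_eq_iff matrix_ring_simps)
qed

lemma bilinear_affine_metric: "bilinear (affine_metric y)"
  unfolding bilinear_def
  by (auto intro!: linearI simp: affine_metric_def matrix_ring_simps retrace_simps add_divide_distrib)

lemma bilinear_affine_christoffel: "bilinear (affine_christoffel y)"
  unfolding bilinear_def
  by (auto intro!: linearI simp: affine_christoffel_def matrix_ring_simps algebra_simps)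

lemma affine_metric_sym: "affine_metric y u v = affine_metric y v u"
proof -
  have "retrace (gram_inv y ** adj u ** cogram_inv y ** v) =
      retrace (adj (gram_inv y ** adj u ** cogram_inv y ** v))" by (simp add: retrace_adj)
  also have "\<dots> = retrace ((adj v ** cogram_inv y ** u) ** gram_inv y)" by (simp add: matrix_ring_simps)
  also have "\<dots> = retrace (gram_inv y ** adj v ** cogram_inv y ** u)"
    by (subst retrace_commute) (simp add: matrix_mul_assoc)
  finally show ?thesis by (simp add: affine_metric_def)
qed

lemma affine_metric_nondegenerate:
  assumes "\<And>z. affine_metric y w z = 0"
  shows "w = 0"
proof -
  \<comment> \<open>The test vector is \<open>w\<close> multiplied by the inverses of both weights,
    which leaves the squared norm of \<open>w\<close>.\<close>
  have "0 = retrace (gram_inv y ** adj w ** cogram_inv y ** ((mat 1 + y ** adj y) ** w ** gram y))"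
    using assms[of "(mat 1 + y ** adj y) ** w ** gram y"] by (simp add: affine_metric_def)
  also have "\<dots> = retrace (gram_inv y ** adj w ** (cogram_inv y ** (mat 1 + y ** adj y)) ** w ** gram y)"
    by (simp only: matrix_mul_assoc)
  also have "\<dots> = retrace (gram_inv y ** (adj w ** w ** gram y))"
    by (simp add: cogram_inv_right matrix_mul_assoc)
  also have "\<dots> = retrace (adj w ** w)"
    by (subst retrace_commute) (simp flip: matrix_mul_assoc)
  also have "\<dots> = w \<bullet> w" by (rule retrace_adj_mult)
  finally show ?thesis by simp
qed

section \<open>Unitary frames\<close>

text \<open>The matrix with \<open>y\<close> above the identity block:
  \<open>graph_plane A y\<close> is the range of \<open>A ** stack y\<close>, and the velocity of
  this frame is the constant family \<open>stack_zero\<close>.\<close>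

definition stack :: "complex^2^'m::finite \<Rightarrow> complex^2^('m + 2)" where
  "stack y = (\<chi> i. case i of Inl j \<Rightarrow> y $ j | Inr k \<Rightarrow> axis k 1)"

definition stack_zero :: "complex^2^'m::finite \<Rightarrow> complex^2^('m + 2)" where
  "stack_zero u = (\<chi> i. case i of Inl j \<Rightarrow> u $ j | Inr k \<Rightarrow> 0)"

lemma sum_UNIV_Plus:
  fixes h :: "'a::finite + 'b::finite \<Rightarrow> 'c::comm_monoid_add"
  shows "sum h UNIV = (\<Sum>j\<in>UNIV. h (Inl j)) + (\<Sum>k\<in>UNIV. h (Inr k))"
  unfolding UNIV_Plus_UNIV[symmetric] by (subst sum.Plus) auto

lemma stack_eq: "stack y = stack 0 + stack_zero y"
  by (simp add: stack_def stack_zero_def vec_eq_iff split: sum.split)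

lemma bounded_linear_stack_zero: "bounded_linear stack_zero"
  unfolding linear_conv_bounded_linear[symmetric]
  by (intro linearI) (simp_all add: stack_zero_def vec_eq_iff split: sum.split)

lemma adj_stack_stack: "adj (stack y) ** stack y = gram y"
proof -
  have "(\<Sum>k\<in>UNIV. cnj (axis k 1 $ i) * axis k 1 $ j) = (if i = j then 1 else 0)" for i j :: 2
    by (simp add: axis_def if_distrib[of cnj] if_distrib[of "\<lambda>t. t * _"] cong: if_cong)
  then show ?thesis
    by (simp add: gram_def vec_eq_iff matrix_matrix_mult_def sum_UNIV_Plus stack_def mat_def)
qed

lemma adj_stack_zero_stack_zero: "adj (stack_zero u) ** stack_zero v = adj u ** v"
  by (simp add: vec_eq_iff matrix_matrix_mult_def sum_UNIV_Plus stack_zero_def)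

lemma adj_stack_zero_stack: "adj (stack_zero u) ** stack y = adj u ** y"
  by (simp add: vec_eq_iff matrix_matrix_mult_def sum_UNIV_Plus stack_zero_def stack_def)

lemma adj_stack_stack_zero: "adj (stack y) ** stack_zero u = adj y ** u"
  using arg_cong[OF adj_stack_zero_stack[of u y], of adj] by (simp add: adj_mult)

lemma stack_derivative: "(stack has_derivative stack_zero) (at y)"
proof -
  have "((\<lambda>y. stack 0 + stack_zero y) has_derivative (\<lambda>u. 0 + stack_zero u)) (at y)"
    by (intro has_derivative_add has_derivative_const
        bounded_linear_imp_has_derivative[OF bounded_linear_stack_zero])
  then show ?thesis by (simp flip: stack_eq)
qed

lemma graph_plane_eq: "graph_plane A y = range (\<lambda>z. A *v (stack y *v z))"
proof -
  have "stack y *v z = (\<chi> i. case i of Inl j \<Rightarrow> (y *v z) $ j | Inr k \<Rightarrow> z $ k)" for z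
    by (simp add: vec_eq_iff matrix_vector_mult_def stack_def axis_def if_distrib[of "\<lambda>t. t * _"]
        split: sum.split cong: if_cong)
  then show ?thesis by (simp add: graph_plane_def)
qed

lemma stack_mult_nth: "(stack y *v z) $ Inl j = (y *v z) $ j" "(stack y *v z) $ Inr k = z $ k"
  by (simp_all add: matrix_vector_mult_def stack_def axis_def if_distrib[of "\<lambda>t. t * _"] cong: if_cong)

text \<open>The lower block of \<open>stack y *v z\<close> is \<open>z\<close> itself, so equal
  points of two graphs have equal parameters and then equal upper blocks.\<close>

lemma inj_graph_plane:
  fixes A :: "complex^('m::finite + 2)^('m + 2)"
  assumes "invertible A"
  shows "inj (graph_plane A)"
proof (rule injI)
  fix y y' :: "complex^2^'m" assume eq: "graph_plane A y = graph_plane A y'"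
  have injA: "inj ((*v) A)"
    using assms matrix_left_invertible_injective invertible_left_inverse by blast
  have "y *v z = y' *v z" for z
  proof -
    have "A *v (stack y *v z) \<in> graph_plane A y" by (simp add: graph_plane_eq)
    then have "A *v (stack y *v z) \<in> graph_plane A y'" unfolding eq .
    then obtain z' where "A *v (stack y *v z) = A *v (stack y' *v z')" unfolding graph_plane_eq by blast
    then have *: "stack y *v z = stack y' *v z'" using injA by (simp add: inj_eq)
    have "z $ k = z' $ k" for k using arg_cong[OF *, of "\<lambda>v. v $ Inr k"] by (simp add: stack_mult_nth)
    then have "z = z'" by (simp add: vec_eq_iff)
    have "(y *v z) $ j = (y' *v z') $ j" for j
      using arg_cong[OF *, of "\<lambda>v. v $ Inl j"] by (simp add: stack_mult_nth)
    then have "y *v z = y' *v z'" by (simp add: vec_eq_iff)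
    with \<open>z = z'\<close> show ?thesis by simp
  qed
  then show "y = y'" by (simp add: matrix_eq)
qed

text \<open>Projectors with equal range fix each other's images, so \<open>P ** P' = P'\<close> and
  \<open>P' ** P = P\<close>; taking adjoints exchanges the two products.\<close>

lemma orth_projector_eqI:
  assumes P: "adj P = P" "P ** P = P" "range ((*v) P) = W"
  shows "orth_projector W = P"
  unfolding orth_projector_def
proof (rule the_equality)
  have absorb: "X ** Y = Y" if "X ** X = X" "range ((*v) X) = W" "range ((*v) Y) = W" for X Y
  proof -
    have "X *v (Y *v v) = Y *v v" for v
    proof -
      have "Y *v v \<in> range ((*v) X)" using that by blast
      then obtain w where "Y *v v = X *v w" by blast
      then show ?thesis using that(1) by (simp add: matrix_vector_mul_assoc)
    qed
    then show ?thesis by (simp add: matrix_eq flip: matrix_vector_mul_assoc)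
  qed
  fix P' assume P': "adj P' = P' \<and> P' ** P' = P' \<and> range ((*v) P') = W"
  have "P' = adj (P ** P')" using absorb[of P P'] P P' by simp
  also have "\<dots> = P" using absorb[of P' P] P P' by (simp add: adj_mult)
  finally show "P' = P" .
qed (use P in blast)

text \<open>For a frame \<open>C\<close> the projector is \<open>C\<close> times the inverse of
  \<open>adj C ** C\<close> times \<open>adj C\<close>; unitarity of \<open>A\<close> makes that
  Gram matrix \<open>gram y\<close>.\<close>

lemma orth_projector_graph_plane:
  assumes A: "adj A ** A = mat 1"
  shows "orth_projector (graph_plane A y) = A ** stack y ** gram_inv y ** adj (A ** stack y)"
proof -
  define C where "C = A ** stack y"
  have C: "adj C ** C = gram y"
  proof -
    have "adj C ** C = adj (stack y) ** (adj A ** A) ** stack y" by (simp add: C_def adj_mult matrix_mul_assoc)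
    then show ?thesis by (simp add: A adj_stack_stack)
  qed
  let ?P = "C ** gram_inv y ** adj C"
  have adj_P: "adj ?P = ?P" by (simp add: matrix_ring_simps)
  have "?P ** ?P = C ** gram_inv y ** (adj C ** C) ** gram_inv y ** adj C"
    by (simp only: matrix_mul_assoc)
  also have "\<dots> = C ** (gram_inv y ** gram y) ** gram_inv y ** adj C"
    by (simp only: C matrix_mul_assoc)
  finally have PP: "?P ** ?P = ?P" by simp
  have PC: "?P ** C = C"
  proof -
    have "?P ** C = C ** gram_inv y ** (adj C ** C)" by (simp only: matrix_mul_assoc)
    also have "\<dots> = C ** (gram_inv y ** gram y)" by (simp only: C matrix_mul_assoc)
    finally show ?thesis by simp
  qed
  have "graph_plane A y = range ((*v) C)" by (simp add: graph_plane_eq C_def matrix_vector_mul_assoc)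
  moreover have "range ((*v) ?P) = range ((*v) C)"
  proof (intro set_eqI iffI)
    fix v assume "v \<in> range ((*v) ?P)"
    then obtain z where "v = ?P *v z" by blast
    then have "v = C *v ((gram_inv y ** adj C) *v z)" by (simp add: matrix_vector_mul_assoc matrix_mul_assoc)
    then show "v \<in> range ((*v) C)" by blast
  next
    fix v assume "v \<in> range ((*v) C)"
    then obtain z where "v = C *v z" by blast
    then have "v = ?P *v (C *v z)" by (simp only: matrix_vector_mul_assoc PC)
    then show "v \<in> range ((*v) ?P)" by blast
  qed
  ultimately have "range ((*v) ?P) = graph_plane A y" by simp
  with adj_P PP have "orth_projector (graph_plane A y) = ?P" by (rule orth_projector_eqI)
  then show ?thesis by (simp only: C_def)
qed

text \<open>The left-hand side is the derivative of the projector \<open>C ** G ** adj C\<close>,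
  for frame velocity \<open>C'\<close> and Gram derivative \<open>S + T\<close>, times the
  projector. The \<open>S\<close> terms cancel. In the application \<open>T\<close> is
  \<open>adj C ** C'\<close>, so \<open>C' - C ** G ** T\<close> is \<open>C'\<close> without its
  component in the plane.\<close>

lemma projector_derivative_identity:
  fixes C C' :: "complex^2^'n::finite" and G H S T :: "complex^2^2"
  assumes "adj C ** C = H" "adj C' ** C = S" "H ** G = mat 1"
  shows "(C ** G ** adj C' + (C ** - (G ** (S + T) ** G) + C' ** G) ** adj C) ** (C ** G ** adj C) =
    (C' - C ** G ** T) ** G ** adj C"
proof -
  have "adj C ** (C ** X) = H ** X" "adj C' ** (C ** X) = S ** X" "H ** (G ** X) = X"
    for X :: "complex^'n^2"
    unfolding matrix_mul_assoc assms by simp_all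
  then show ?thesis
    by (simp add: matmul.add_left matmul.add_right matmul.diff_left matmul.diff_right
        matmul.minus_left matmul.minus_right flip: matrix_mul_assoc)
qed

text \<open>\<open>A\<close> enters only through products \<open>adj (A ** X) ** (A ** Y)\<close>,
  from which unitarity removes it. This is the homogeneity of the metric under the unitary
  group.\<close>

lemma grass_metric_unitary_chart:
  fixes A :: "complex^('m::finite + 2)^('m + 2)"
  assumes A: "adj A ** A = mat 1" and inv: "chart_inv d = graph_plane A"
  shows "grass_metric d = affine_metric"
proof (intro ext)
  fix y u v :: "complex^2^'m"
  let ?C = "\<lambda>y. A ** stack y" and ?C' = "\<lambda>u. A ** stack_zero u" and ?G = "gram_inv y"
  have unitary: "adj (A ** X) ** (A ** Y) = adj X ** Y" for X Y :: "complex^2^('m + 2)"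
  proof -
    have "adj (A ** X) ** (A ** Y) = adj X ** (adj A ** A) ** Y" by (simp add: adj_mult matrix_mul_assoc)
    then show ?thesis by (simp add: A)
  qed
  note blocks = unitary adj_stack_stack adj_stack_stack_zero adj_stack_zero_stack adj_stack_zero_stack_zero
  have P: "(\<lambda>y. orth_projector (chart_inv d y)) = (\<lambda>y. ?C y ** gram_inv y ** adj (?C y))"
    by (simp add: inv orth_projector_graph_plane[OF A])
  have C_deriv: "(?C has_derivative ?C') (at y)"
    by (rule has_derivative_eq_rhs[OF matmul.FDERIV[OF has_derivative_const stack_derivative]])
      (simp add: fun_eq_iff matmul.zero_left)
  define K where "K u = ?C' u - ?C y ** ?G ** (adj y ** u)" for u
  have hom: "hom_vector d y u = K u ** ?G ** adj (?C y)" for u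
  proof -
    have "D (\<lambda>y. orth_projector (chart_inv d y)) y u =
        ?C y ** ?G ** adj (?C' u) +
        (?C y ** - (?G ** (adj u ** y + adj y ** u) ** ?G) + ?C' u ** ?G) ** adj (?C y)"
      unfolding P
      using frechet_derivativeI[OF matmul.FDERIV[OF matmul.FDERIV[OF C_deriv gram_inv_derivative]
          bounded_linear.has_derivative[OF bounded_linear_adj C_deriv]]] by simp
    then have "hom_vector d y u = (?C y ** ?G ** adj (?C' u) +
        (?C y ** - (?G ** (adj u ** y + adj y ** u) ** ?G) + ?C' u ** ?G) ** adj (?C y)) **
        (?C y ** ?G ** adj (?C y))"
      using fun_cong[OF P, of y] by (simp add: hom_vector_def)
    also have "\<dots> = K u ** ?G ** adj (?C y)"
      unfolding K_def by (rule projector_derivative_identity[where H = "gram y"]) (simp_all add: blocks)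
    finally show ?thesis .
  qed
  have K: "adj (K u) ** K v = adj u ** cogram_inv y ** v"
  proof -
    have "adj (K u) = adj (?C' u) - adj u ** y ** ?G ** adj (?C y)"
      by (simp add: K_def matrix_ring_simps)
    then have "adj (K u) ** K v =
        adj (?C' u) ** ?C' v - adj u ** y ** ?G ** (adj (?C y) ** ?C' v) -
        ((adj (?C' u) ** ?C y) ** ?G ** adj y ** v -
         adj u ** y ** (?G ** (adj (?C y) ** ?C y)) ** ?G ** adj y ** v)"
      unfolding K_def by (simp only: matmul.diff_left matmul.diff_right matrix_mul_assoc)
    then show ?thesis
      unfolding blocks by (simp add: cogram_inv_def matmul.diff_left matmul.diff_right matrix_mul_assoc)
  qed
  have "retrace (adj (hom_vector d y u) ** hom_vector d y v) =
      retrace ((?C y ** ?G) ** (adj (K u) ** K v ** ?G ** adj (?C y)))"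
    by (simp add: hom adj_mult matrix_mul_assoc)
  also have "\<dots> = retrace (adj (K u) ** K v ** ?G ** (adj (?C y) ** ?C y) ** ?G)"
    by (subst retrace_commute) (simp only: matrix_mul_assoc)
  also have "\<dots> = retrace (adj (K u) ** K v ** (?G ** gram y) ** ?G)"
    unfolding unitary adj_stack_stack by (simp only: matrix_mul_assoc)
  also have "\<dots> = retrace (?G ** (adj (K u) ** K v))"
    by (subst retrace_commute) simp
  finally show "grass_metric d y u v = affine_metric y u v"
    by (simp add: grass_metric_def affine_metric_def K matrix_mul_assoc retrace_def)
qed

text \<open>The Hermitian product; \<open>\<bullet>\<close> is only its real part and does not
  detect complex orthogonality.\<close>

definition cinner :: "complex^'n::finite \<Rightarrow> complex^'n \<Rightarrow> complex" where
  "cinner u v = (\<Sum>i\<in>UNIV. cnj (u $ i) * v $ i)"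

lemma cinner_diff_right: "cinner u (v - w) = cinner u v - cinner u w"
  by (simp add: cinner_def sum_subtractf algebra_simps)

lemma cinner_scale_right: "cinner u (c *s v) = c * cinner u v"
  by (simp add: cinner_def sum_distrib_left mult_ac)

lemma cinner_scale_left: "cinner (c *s u) v = cnj c * cinner u v"
  by (simp add: cinner_def sum_distrib_left mult_ac)

lemma cinner_sum_right: "cinner u (\<Sum>j\<in>J. h j) = (\<Sum>j\<in>J. cinner u (h j))"
  unfolding cinner_def by (subst sum.swap) (simp add: sum_distrib_left)

lemma cinner_commute: "cinner v u = cnj (cinner u v)"
  by (simp add: cinner_def mult.commute)

lemma cinner_self: "cinner v v = of_real ((norm v)\<^sup>2)"
proof -
  have "cinner v v = (\<Sum>i\<in>UNIV. of_real ((norm (v $ i))\<^sup>2))"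
    unfolding cinner_def by (intro sum.cong refl) (metis complex_norm_square mult.commute)
  also have "\<dots> = of_real ((norm v)\<^sup>2)"
    by (simp add: norm_vec_def L2_set_def real_sqrt_pow2 sum_nonneg)
  finally show ?thesis .
qed

definition orthonormal :: "'i set \<Rightarrow> ('i \<Rightarrow> complex^'n::finite) \<Rightarrow> bool" where
  "orthonormal I e \<longleftrightarrow> (\<forall>i\<in>I. \<forall>j\<in>I. cinner (e i) (e j) = (if i = j then 1 else 0))"

text \<open>One Gram-Schmidt step: a vector of \<open>V\<close> outside the span exists by
  dimension; its projection is subtracted and the rest normalized.\<close>

lemma orthonormal_extend_one:
  fixes e :: "'i \<Rightarrow> complex^'n::finite"
  assumes V: "vec.subspace V" and I: "finite I" "e ` I \<subseteq> V" "orthonormal I e" and dim: "card I < vec.dim V"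
  obtains v where "v \<in> V" "cinner v v = 1" "\<And>i. i \<in> I \<Longrightarrow> cinner (e i) v = 0"
proof -
  have "\<not> V \<subseteq> vec.span (e ` I)"
  proof
    assume "V \<subseteq> vec.span (e ` I)"
    then have "vec.dim V \<le> card (e ` I)" using vec.dim_le_card I(1) by blast
    also have "\<dots> \<le> card I" using card_image_le[OF I(1)] .
    finally show False using dim by simp
  qed
  then obtain x where x: "x \<in> V" "x \<notin> vec.span (e ` I)" by blast
  define p where "p = (\<Sum>i\<in>I. cinner (e i) x *s e i)"
  have "p \<in> vec.span (e ` I)"
    unfolding p_def by (intro vec.span_sum vec.span_scale vec.span_base) auto
  then have ne: "x - p \<noteq> 0" using x by auto
  have "p \<in> V"
    unfolding p_def using I V by (intro vec.subspace_sum vec.subspace_scale) auto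
  then have "x - p \<in> V" using x V vec.subspace_diff by blast
  have orth: "cinner (e j) (x - p) = 0" if "j \<in> I" for j
  proof -
    have "cinner (e j) p = (\<Sum>i\<in>I. cinner (e i) x * (if j = i then 1 else 0))"
      using I(3) that by (simp add: p_def cinner_sum_right cinner_scale_right orthonormal_def)
    also have "\<dots> = cinner (e j) x" using that I(1) by (simp add: if_distrib cong: if_cong)
    finally show ?thesis by (simp add: cinner_diff_right)
  qed
  let ?v = "complex_of_real (1 / norm (x - p)) *s (x - p)"
  show ?thesis
  proof
    show "?v \<in> V" using \<open>x - p \<in> V\<close> V vec.subspace_scale by blast
    show "cinner ?v ?v = 1"
    proof -
      have "cinner (c *s w) (c *s w) = 1" if "w \<noteq> 0" "c = complex_of_real (1 / norm w)"
        for w :: "complex^'n" and c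
        unfolding cinner_scale_left cinner_scale_right cinner_self[of w]
        using that by (simp add: power2_eq_square)
      then show ?thesis using ne by blast
    qed
    show "cinner (e i) ?v = 0" if "i \<in> I" for i
      unfolding cinner_scale_right orth[OF that] by simp
  qed
qed

text \<open>Used twice for a frame adapted to a plane: with \<open>I = {}\<close> inside the plane,
  then with the resulting family prescribed, inside the whole space.\<close>

lemma orthonormal_extend:
  fixes e :: "'i \<Rightarrow> complex^'n::finite"
  assumes V: "vec.subspace V" and J: "finite J" "finite I" "e ` I \<subseteq> V" "orthonormal I e"
    and dim: "card (I \<union> J) \<le> vec.dim V" and disj: "I \<inter> J = {}"
  shows "\<exists>e'. e' ` (I \<union> J) \<subseteq> V \<and> orthonormal (I \<union> J) e' \<and> (\<forall>i\<in>I. e' i = e i)"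
  using J(1) dim disj
proof (induction J)
  case empty
  then show ?case using J by auto
next
  case (insert j J)
  have fin: "finite (I \<union> J)" and j: "j \<notin> I \<union> J" using insert J by auto
  have card: "card (I \<union> insert j J) = Suc (card (I \<union> J))" using fin j by simp
  then obtain e' where e': "e' ` (I \<union> J) \<subseteq> V" "orthonormal (I \<union> J) e'" "\<forall>i\<in>I. e' i = e i"
    using insert by auto
  obtain v where v: "v \<in> V" "cinner v v = 1" "\<And>i. i \<in> I \<union> J \<Longrightarrow> cinner (e' i) v = 0"
    using orthonormal_extend_one[OF V fin e'(1,2)] card insert.prems by auto
  have v': "cinner v (e' i) = 0" if "i \<in> I \<union> J" for i
    using v(3)[OF that] cinner_commute[of v "e' i"] by simp
  let ?e = "e'(j := v)"
  have "?e ` (I \<union> insert j J) \<subseteq> V" using v e' by auto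
  moreover have "orthonormal (I \<union> insert j J) ?e"
    using e'(2) v v' j unfolding orthonormal_def by auto
  moreover have "\<forall>i\<in>I. ?e i = e i" using e'(3) j by auto
  ultimately show ?case by blast
qed

lemma adj_mult_columns: "(adj X ** Y) $ i $ j = cinner (column i X) (column j Y)"
  by (simp add: matrix_matrix_mult_def cinner_def column_def)

text \<open>The graph of the zero matrix is spanned by the \<open>Inr\<close> columns of
  \<open>A\<close>, so these are chosen as an orthonormal basis of \<open>W\<close> and the
  \<open>Inl\<close> columns complete it.\<close>

lemma two_plane_unitary_frame:
  fixes W :: "(complex^('m::finite + 2)) set"
  assumes "W \<in> two_planes"
  obtains A :: "complex^('m + 2)^('m + 2)" where "adj A ** A = mat 1" "graph_plane A 0 = W"
proof -
  have W: "vec.subspace W" "vec.dim W = 2" using assms by (auto simp: two_planes_def)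
  have card_Inr: "card (range (Inr :: 2 \<Rightarrow> 'm + 2)) = 2" by (simp add: card_image)
  have "\<exists>e. e ` ({} \<union> range Inr) \<subseteq> W \<and> orthonormal ({} \<union> range (Inr :: 2 \<Rightarrow> 'm + 2)) e \<and> (\<forall>i\<in>{}. e i = 0)"
    by (rule orthonormal_extend[OF W(1)]) (use W card_Inr in \<open>auto simp: orthonormal_def\<close>)
  then obtain e where e: "e ` range Inr \<subseteq> W" "orthonormal (range (Inr :: 2 \<Rightarrow> 'm + 2)) e" by auto
  have "range Inr \<union> range Inl = (UNIV :: ('m + 2) set)" by (auto simp: UNIV_sum)
  then have "\<exists>e'. e' ` (range Inr \<union> range Inl) \<subseteq> (UNIV :: (complex^('m + 2)) set) \<and>
      orthonormal (range Inr \<union> range Inl) e' \<and> (\<forall>i\<in>range Inr. e' i = e i)"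
    by (intro orthonormal_extend) (use e(2) in \<open>auto simp: vec_dim_card vec.subspace_UNIV simp del: vec.dim_UNIV\<close>)
  then obtain e' :: "'m + 2 \<Rightarrow> complex^('m + 2)" where e': "orthonormal UNIV e'" "\<And>k. e' (Inr k) = e (Inr k)"
    using \<open>range Inr \<union> range Inl = UNIV\<close> by auto
  define A where "A = (\<chi> i j. e' j $ i)"
  have col: "column j A = e' j" for j by (simp add: A_def column_def vec_eq_iff)
  have A: "adj A ** A = mat 1"
    using e'(1) by (simp add: vec_eq_iff adj_mult_columns col mat_def orthonormal_def)
  let ?C = "A ** stack 0"
  have C: "?C *v z = (\<Sum>k\<in>UNIV. z $ k *s e (Inr k))" for z
  proof -
    have "?C *v z = A *v (stack 0 *v z)" by (simp add: matrix_vector_mul_assoc)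
    also have "\<dots> = (\<Sum>i\<in>UNIV. (stack 0 *v z) $ i *s column i A)" by (rule matrix_mult_sum)
    finally show ?thesis by (simp add: sum_UNIV_Plus stack_mult_nth col e'(2))
  qed
  have range_eq: "graph_plane A 0 = range ((*v) ?C)" by (simp add: graph_plane_eq matrix_vector_mul_assoc)
  have sub: "range ((*v) ?C) \<subseteq> W"
    unfolding C using e(1) W(1) by (auto intro!: vec.subspace_sum vec.subspace_scale)
  have "adj ?C ** ?C = adj (stack 0) ** (adj A ** A) ** stack 0" by (simp add: adj_mult matrix_mul_assoc)
  also have "\<dots> = mat 1" by (simp add: A adj_stack_stack gram_def)
  finally have "inj ((*v) ?C)" using matrix_left_invertible_injective by blast
  then have "vec.dim (range ((*v) ?C)) = 2"
    using vec.dim_image_eq[OF matrix_vector_mul_linear_gen, of ?C UNIV]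
    by (simp add: vec_dim_card del: vec.dim_UNIV)
  moreover have "vec.subspace (range ((*v) ?C))"
    by (rule module_hom.subspace_image[OF Vector_Spaces.linear.axioms(3)[OF matrix_vector_mul_linear_gen]
          vec.subspace_UNIV])
  ultimately have "range ((*v) ?C) = W"
    using vec.subspace_dim_equal[OF _ W(1) sub] W(2) by simp
  then show ?thesis using that A range_eq by simp
qed

section \<open>Algebraic obstruction\<close>

text \<open>\<open>adj n\<close> maps a space of dimension at least 3 to one of dimension 2, so it
  has a kernel.\<close>

lemma exists_orthogonal_to_columns:
  fixes n :: "complex^2^'m::finite"
  assumes "CARD('m) \<ge> 3"
  obtains e where "e \<noteq> 0" "adj n *v e = 0"
proof -
  have "\<not> inj ((*v) (adj n))"
  proof
    assume "inj ((*v) (adj n))"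
    then have "vec.dim (range ((*v) (adj n))) = CARD('m)"
      using vec.dim_image_eq[OF matrix_vector_mul_linear_gen, of "adj n" UNIV]
      by (simp add: vec_dim_card del: vec.dim_UNIV)
    moreover have "vec.dim (range ((*v) (adj n))) \<le> vec.dim (UNIV :: (complex^2) set)"
      by (rule vec.dim_subset) simp
    ultimately show False using assms by (simp add: vec_dim_card del: vec.dim_UNIV)
  qed
  then have "\<not> (\<forall>x. adj n *v x = 0 \<longrightarrow> x = 0)"
    using matrix_left_invertible_ker[of "adj n"] matrix_left_invertible_injective[of "adj n"] by blast
  then show ?thesis using that by blast
qed

definition column_embed :: "2 \<Rightarrow> complex^'m::finite \<Rightarrow> complex \<Rightarrow> complex^2^'m" where
  "column_embed k e \<alpha> = (\<chi> i l. if l = k then \<alpha> * e $ i else 0)"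

lemma linear_column_embed: "linear (column_embed k e)"
  by (intro linearI) (auto simp: column_embed_def vec_eq_iff algebra_simps)

text \<open>Serves twice: it makes these matrices tangent at the origin, and it removes half of the
  curvature terms.\<close>

lemma adj_column_embed_mult:
  assumes "adj n *v e = 0"
  shows "adj (column_embed k e \<alpha>) ** n = 0"
proof -
  have "(\<Sum>i\<in>UNIV. cnj (e $ i) * n $ i $ l) = 0" for l
    using arg_cong[OF assms, of "\<lambda>v. cnj (v $ l)"] by (simp add: matrix_vector_mult_def mult.commute)
  moreover have "(\<Sum>i\<in>UNIV. cnj (\<alpha> * e $ i) * n $ i $ l) = cnj \<alpha> * (\<Sum>i\<in>UNIV. cnj (e $ i) * n $ i $ l)" for l
    by (simp add: sum_distrib_left mult.assoc)
  ultimately have "(adj (column_embed k e \<alpha>) ** n) $ i $ l = 0" for i l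
    by (cases "i = k") (simp_all add: matrix_matrix_mult_def column_embed_def)
  then show ?thesis by (simp add: vec_eq_iff)
qed

text \<open>The \<open>2 \<times> 2\<close> matrix that multiplies \<open>n\<close> is skew-Hermitian and invertible, so it has no real
  eigenvalue.\<close>

lemma normal_zero_of_column_codazzi:
  fixes n :: "complex^2^'m::finite"
  assumes e: "e \<noteq> 0" and \<alpha>\<beta>: "\<alpha> \<noteq> 0" "\<beta> \<noteq> 0"
    and X: "X = column_embed 1 e \<alpha>" and Y: "Y = column_embed 2 e \<beta>"
    and eq: "n ** (adj X ** Y - adj Y ** X) = \<mu> *\<^sub>R n"
  shows "n = 0"
proof -
  define a where "a = cnj \<alpha> * \<beta> * of_real ((norm e)\<^sup>2)"
  have a: "a \<noteq> 0" using e \<alpha>\<beta> by (simp add: a_def)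
  have e2: "(\<Sum>i\<in>UNIV. cnj (e $ i) * e $ i) = of_real ((norm e)\<^sup>2)"
    using cinner_self[of e] by (simp add: cinner_def)
  have sum: "(\<Sum>i\<in>UNIV. cnj (z * e $ i) * (w * e $ i)) = cnj z * w * of_real ((norm e)\<^sup>2)" for z w
    unfolding e2[symmetric] sum_distrib_left by (intro sum.cong) (simp_all add: mult_ac)
  define K where "K = adj X ** Y - adj Y ** X"
  have K: "K $ 1 $ 1 = 0" "K $ 2 $ 2 = 0" "K $ 1 $ 2 = a" "K $ 2 $ 1 = - cnj a"
    using sum[of \<alpha> \<beta>] sum[of \<beta> \<alpha>]
    by (simp_all add: K_def X Y matrix_matrix_mult_def column_embed_def a_def mult_ac)
  have entries: "- (n $ i $ 2 * cnj a) = of_real \<mu> * n $ i $ 1" "n $ i $ 1 * a = of_real \<mu> * n $ i $ 2" for i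
    using arg_cong[OF eq[folded K_def], of "\<lambda>m. m $ i $ 1"] arg_cong[OF eq[folded K_def], of "\<lambda>m. m $ i $ 2"]
    by (simp_all add: matrix_matrix_mult_def[of n] sum_2 K scaleR_conv_of_real[where 'a=complex])
  have "n $ i $ 2 = 0" for i
  proof -
    \<comment> \<open>Eliminating \<open>n $ i $ 1\<close> from the two entry equations leaves the
      characteristic polynomial of \<open>K\<close> at \<mu> as the factor of
      \<open>n $ i $ 2\<close>; it is positive since \<open>a\<close> is nonzero.\<close>
    have "of_real ((norm a)\<^sup>2 + \<mu>\<^sup>2) * n $ i $ 2 = (a * cnj a) * n $ i $ 2 + of_real \<mu> * (of_real \<mu> * n $ i $ 2)"
      by (simp add: complex_norm_square[symmetric] algebra_simps power2_eq_square)
    also have "\<dots> = a * (n $ i $ 2 * cnj a) + of_real \<mu> * (n $ i $ 1 * a)"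
      unfolding entries(2)[symmetric] by (simp only: mult_ac)
    also have "\<dots> = - (a * - (n $ i $ 2 * cnj a)) + a * (of_real \<mu> * n $ i $ 1)"
      by (simp add: mult_ac)
    also have "\<dots> = 0" by (simp add: entries(1))
    finally have "complex_of_real ((norm a)\<^sup>2 + \<mu>\<^sup>2) * n $ i $ 2 = 0" .
    moreover have "(norm a)\<^sup>2 + \<mu>\<^sup>2 \<noteq> 0" using a by (simp add: add_nonneg_eq_0_iff)
    ultimately show ?thesis by (metis mult_eq_0_iff of_real_eq_0_iff)
  qed
  moreover have "n $ i $ 1 = 0" for i using entries(2)[of i] calculation a by simp
  ultimately show ?thesis by (simp add: vec_eq_iff forall_2)
qed

section \<open>The contradiction in the chart centred at a point of the hypersurface\<close>

lemma local_hypersurface_affine: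
  fixes F n :: "real^'k::finite \<Rightarrow> complex^2^'m::finite"
  assumes "open U" "smooth_on U F" "smooth_on U n" "\<And>x. x \<in> U \<Longrightarrow> inj (D F x)"
    "\<And>x. x \<in> U \<Longrightarrow> affine_metric (F x) (n x) (n x) = 1"
    "\<And>x t. x \<in> U \<Longrightarrow> affine_metric (F x) (n x) (D F x t) = 0"
    "CARD('k) + 1 = 4 * CARD('m)"
  shows "local_hypersurface affine_metric affine_christoffel U F n"
proof
  show "(\<lambda>y. affine_metric y u v) differentiable (at y)" for u v y :: "complex^2^'m"
    using affine_metric_derivative unfolding differentiable_def by blast
  show "(\<lambda>y. affine_christoffel y u v) differentiable (at y)" for u v y :: "complex^2^'m"
    using affine_christoffel_derivative unfolding differentiable_def by blast
  show "w = 0" if "\<And>z. affine_metric y w z = 0" for y w :: "complex^2^'m"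
    using affine_metric_nondegenerate that by blast
  show "DIM(complex^2^'m) = CARD('k) + 1" using assms(7) by simp
qed (fact bilinear_affine_metric affine_metric_sym affine_koszul bilinear_affine_christoffel assms)+

lemma not_recurrent_at_origin:
  fixes F n :: "real^'k::finite \<Rightarrow> complex^2^'m::finite"
  assumes "local_hypersurface affine_metric affine_christoffel U F n"
    and m: "CARD('m) \<ge> 3" and x: "x \<in> U" "F x = 0" and \<omega>: "linear (\<omega> :: _ \<Rightarrow> real)"
    and recurrent: "\<And>u w. cov_deriv_endo (pullback_metric affine_metric F)
      (local_hypersurface.shape affine_metric F n) x u w =
      \<omega> u *\<^sub>R local_hypersurface.shape affine_metric F n x w"
  shows False
proof -
  interpret local_hypersurface affine_metric affine_christoffel U F n by fact
  obtain e where e: "e \<noteq> 0" "adj (n x) *v e = 0" using exists_orthogonal_to_columns[OF m] .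
  have kernel: "\<exists>\<alpha> u. \<alpha> \<noteq> 0 \<and> D F x u = column_embed k e \<alpha> \<and> \<omega> u = 0" for k
  proof -
    have "\<exists>u. D F x u = column_embed k e \<alpha>" for \<alpha>
    proof (rule tangentI[OF x(1)])
      have "column_embed k e \<alpha> \<bullet> n x = 0"
        using retrace_adj_mult[of "column_embed k e \<alpha>" "n x"] adj_column_embed_mult[OF e(2)]
        by (simp add: retrace_def trace_def)
      then show "affine_metric (F x) (n x) (column_embed k e \<alpha>) = 0"
        by (simp add: x affine_metric_zero inner_commute)
    qed
    then obtain v where v: "D F x (v \<alpha>) = column_embed k e \<alpha>" for \<alpha> by metis
    show ?thesis
    proof (cases "\<omega> (v 1) = 0")
      case True
      then show ?thesis using v[of 1] by (intro exI[of _ 1] exI[of _ "v 1"]) simp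
    next
      case False
      \<comment> \<open>The combination of the lifts of 1 and \<i> that \<omega> annihilates; its
        coefficient is nonzero because its imaginary part is
        \<open>- \<omega> (v 1)\<close>.\<close>
      let ?u = "\<omega> (v \<i>) *\<^sub>R v 1 - \<omega> (v 1) *\<^sub>R v \<i>" and ?\<alpha> = "\<omega> (v \<i>) *\<^sub>R 1 - \<omega> (v 1) *\<^sub>R \<i>"
      have "D F x ?u = column_embed k e ?\<alpha>"
        using v linear_column_embed[of k e] DF_linear[OF x(1)]
        by (simp only: linear_diff linear_scale)
      moreover have "\<omega> ?u = 0" using \<omega> by (simp add: linear_diff linear_scale)
      moreover have "?\<alpha> \<noteq> 0" using False by (simp add: complex_eq_iff)
      ultimately show ?thesis by blast
    qed
  qed
  obtain \<alpha> u where u: "\<alpha> \<noteq> 0" "D F x u = column_embed 1 e \<alpha>" "\<omega> u = 0" using kernel by blast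
  obtain \<beta> w where w: "\<beta> \<noteq> 0" "D F x w = column_embed 2 e \<beta>" "\<omega> w = 0" using kernel by blast
  \<comment> \<open>Every term of the metric derivative contains \<open>y\<close> or
    \<open>adj y\<close> as a factor, so all vanish at the origin.\<close>
  have flat: "D (\<lambda>y. affine_metric y a b) (F x) h = 0" for a b h
    using frechet_derivativeI[OF affine_metric_derivative[of a b "F x"]]
    by (simp add: x matrix_ring_simps retrace_simps retrace_def trace_def)
  have \<Gamma>': "D (\<lambda>y. affine_christoffel y b c) (F x) a = - (b ** adj a ** c + c ** adj a ** b)" for a b c
    using frechet_derivativeI[OF affine_christoffel_derivative[of b c "F x"]]
    by (simp add: x matrix_ring_simps)
  obtain \<mu> where \<mu>: "D F x (cov_deriv_endo (pullback_metric affine_metric F) shape x u w -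
      cov_deriv_endo (pullback_metric affine_metric F) shape x w u) =
    D (\<lambda>y. affine_christoffel y (D F x u) (n x)) (F x) (D F x w) -
    D (\<lambda>y. affine_christoffel y (D F x w) (n x)) (F x) (D F x u) + \<mu> *\<^sub>R n x"
    using codazzi[OF x(1) flat] by blast
  let ?X = "column_embed 1 e \<alpha>" and ?Y = "column_embed 2 e \<beta>"
  \<comment> \<open>Recurrence makes the left-hand side of the Codazzi equation a combination of
    shape vectors with coefficients \<open>\<omega> u\<close> and \<open>\<omega> w\<close>, both
    zero.\<close>
  have "0 = - (?X ** (adj ?Y ** n x) + n x ** adj ?Y ** ?X) + (?Y ** (adj ?X ** n x) + n x ** adj ?X ** ?Y) +
      \<mu> *\<^sub>R n x"
    using \<mu> by (simp add: recurrent u w \<Gamma>' linear_0[OF DF_linear[OF x(1)]] matrix_mul_assoc)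
      (simp add: algebra_simps)
  also have "\<dots> = n x ** (adj ?X ** ?Y - adj ?Y ** ?X) + \<mu> *\<^sub>R n x"
    by (simp add: adj_column_embed_mult[OF e(2)] matmul.zero_right matmul.diff_right matrix_mul_assoc)
  finally have "n x ** (adj ?X ** ?Y - adj ?Y ** ?X) = (- \<mu>) *\<^sub>R n x"
    by (simp add: add_eq_0_iff2)
  then have "n x = 0"
    by (rule normal_zero_of_column_codazzi[OF e(1) u(1) w(1) refl refl])
  then show False using n_unit[OF x(1)] by (simp add: g_simps)
qed

theorem corollary21:
  assumes "CARD('m::finite) \<ge> 3"
  shows "\<not> (\<exists>(T :: 'a topology) (\<A> :: ('a, real^'k) chart set)
              (f :: 'a \<Rightarrow> (complex^('m + 2)) set) N.
            real_hypersurface T \<A> f N \<and>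
            recurrent_hypersurface \<A> grass_atlas grass_metric f N)"
proof
  assume "\<exists>(T :: 'a topology) (\<A> :: ('a, real^'k) chart set)
              (f :: 'a \<Rightarrow> (complex^('m + 2)) set) N.
            real_hypersurface T \<A> f N \<and>
            recurrent_hypersurface \<A> grass_atlas grass_metric f N"
  then obtain T :: "'a topology" and \<A> :: "('a, real^'k) chart set"
    and f :: "'a \<Rightarrow> (complex^('m + 2)) set" and N
    where hyp: "real_hypersurface T \<A> f N"
      and rec: "recurrent_hypersurface \<A> grass_atlas grass_metric f N" by blast
  have dim: "CARD('k) = 4 * CARD('m) - 1"
    and mfd: "smooth_manifold T \<A>" and planes: "f ` topspace T \<subseteq> two_planes"
    and imm: "immersion T \<A> grass_atlas f" and normal: "unit_normal_field \<A> grass_atlas grass_metric f N"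
    using hyp by (auto simp: real_hypersurface_def)
  \<comment> \<open>The nonvanishing of the shape operator supplies a point of the
    hypersurface.\<close>
  obtain c p where c: "c \<in> \<A>" and p: "p \<in> fst c"
    using rec by (auto simp: recurrent_hypersurface_def overlap_def)
  obtain \<omega> where \<omega>: "one_form \<A> \<omega>"
    and rec_eq: "\<And>c d p u w. c \<in> \<A> \<Longrightarrow> d \<in> grass_atlas \<Longrightarrow> p \<in> overlap c d f \<Longrightarrow>
      cov_deriv_endo (induced_metric grass_metric f c d) (shape_operator grass_metric f N c d) (snd c p) u w =
      \<omega> p c u *\<^sub>R shape_operator grass_metric f N c d (snd c p) w"
    using rec unfolding recurrent_hypersurface_def by blast
  have "p \<in> topspace T" using mfd c p unfolding smooth_manifold_def by blast
  then have "f p \<in> two_planes" using planes by blast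
  then obtain A :: "complex^('m + 2)^('m + 2)" where A: "adj A ** A = mat 1" "graph_plane A 0 = f p"
    by (rule two_plane_unitary_frame)
  have invA: "invertible A" using A(1) invertible_left_inverse by blast
  \<comment> \<open>The recurrence equation holds in every chart of \<open>grass_atlas\<close>, so
    it may be read in the one that sends \<open>f p\<close> to the origin.\<close>
  define d where "d = (range (graph_plane A), inv (graph_plane A))"
  have d: "d \<in> grass_atlas" using invA by (auto simp: grass_atlas_def d_def)
  have d_inv: "snd d (graph_plane A y) = y" for y
    using inj_graph_plane[OF invA] by (simp add: d_def inv_f_f)
  have "chart_inv d y = graph_plane A y" for y
  proof -
    have "inj_on (snd d) (fst d)" by (auto simp: inj_on_def d_inv) (auto simp: d_def inv_f_f inj_graph_plane[OF invA])
    then show ?thesis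
      using inv_into_f_f[of "snd d" "fst d" "graph_plane A y"] d_inv[of y]
      by (simp add: chart_inv_def) (simp add: d_def)
  qed
  then have metric: "grass_metric d = affine_metric"
    by (intro grass_metric_unitary_chart[OF A(1)]) auto
  define F where "F = coord_map c d f"
  define n where "n x = N (chart_inv c x) d" for x
  let ?U = "snd c ` overlap c d f"
  have chart: "openin T (fst c)" "open (snd c ` fst c)"
    "homeomorphic_map (subtopology T (fst c)) (top_of_set (snd c ` fst c)) (snd c)"
    using mfd c unfolding smooth_manifold_def by blast+
  have sub: "overlap c d f \<subseteq> fst c" by (auto simp: overlap_def)
  have "fst c \<subseteq> topspace T" using chart(1) openin_subset by blast
  then have inj_c: "inj_on (snd c) (fst c)"
    using homeomorphic_imp_injective_map[OF chart(3)] by (simp add: Int_absorb1)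
  have c_inv: "chart_inv c (snd c q) = q" if "q \<in> overlap c d f" for q
    using inj_c sub that by (auto simp: chart_inv_def intro!: inv_into_f_f)
  have "openin T (overlap c d f)" using imm c d unfolding immersion_def by blast
  then have "openin (subtopology T (fst c)) (overlap c d f)"
    using sub by (meson openin_subset_topspace_eq openin_open_subtopology chart(1))
  then have "openin (top_of_set (snd c ` fst c)) ?U"
    using homeomorphic_imp_open_map[OF chart(3)] by (simp add: open_map_def)
  then have U: "open ?U" using chart(2) openin_open_trans by blast
  have p_overlap: "p \<in> overlap c d f"
    using p A(2) by (auto simp: overlap_def d_def)
  have F: "smooth_on ?U F" "\<And>x. x \<in> ?U \<Longrightarrow> inj (D F x)"
    using imm c d unfolding immersion_def F_def by blast+
  have n: "smooth_on ?U n"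
    and nn: "\<And>q. q \<in> overlap c d f \<Longrightarrow> affine_metric (snd d (f q)) (N q d) (N q d) = 1"
    and nt: "\<And>q u. q \<in> overlap c d f \<Longrightarrow> affine_metric (snd d (f q)) (N q d) (D F (snd c q) u) = 0"
    using normal c d unfolding unit_normal_field_def n_def F_def metric[symmetric] by blast+
  have F_c: "F (snd c q) = snd d (f q)" if "q \<in> overlap c d f" for q
    using c_inv[OF that] by (simp add: F_def coord_map_def)
  have local: "local_hypersurface affine_metric affine_christoffel ?U F n"
    using U F n nn nt dim assms by (intro local_hypersurface_affine) (auto simp: F_c n_def c_inv)
  have shape: "shape_operator grass_metric f N c d = local_hypersurface.shape affine_metric F n"
    unfolding local_hypersurface.shape_def[OF local, abs_def] shape_operator_def[abs_def]
    by (simp add: metric F_def n_def[abs_def])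
  have induced: "induced_metric grass_metric f c d = pullback_metric affine_metric F"
    by (simp add: induced_metric_def metric F_def)
  show False
  proof (rule not_recurrent_at_origin[OF local assms])
    show "snd c p \<in> ?U" using p_overlap by blast
    show "F (snd c p) = 0" using F_c[OF p_overlap] d_inv[of 0] A(2) by simp
    show "linear (\<omega> p c)" using \<omega> c p unfolding one_form_def by blast
    show "cov_deriv_endo (pullback_metric affine_metric F) (local_hypersurface.shape affine_metric F n) (snd c p) u w =
      \<omega> p c u *\<^sub>R local_hypersurface.shape affine_metric F n (snd c p) w" for u w
      using rec_eq[OF c d p_overlap, of u w] unfolding shape induced .
  qed
qed

end
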